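(* Let $H$ be an infinite-dimensional, separable, complex Hilbert space and let $U(H)$ be its unitary group. Let $N = \{u \in U(H) : u - 1 \text{ is a compact operator}\}$, a normal subgroup of $U(H)$. Then the quotient group $U(H)/N$ does not admit a non-trivial homomorphism to a separable Hausdorff topological group; that is, every group homomorphism (not assumed continuous) from $U(H)/N$ to a separable Hausdorff topological group is trivial.
   Context: A topological group is separable if it has a countable dense subset. $U(H)$ is the group of all unitary operators on $H$. *)

theory Defs
  imports "HOL-Analysis.Analysis" "HOL-Algebra.Coset"
begin

text \<open>
  The base class \<open>banach\<close> provides the real vector space structure, the norm, its topology and
  completeness; the axioms below say that the real structure and the norm are the ones induced by
  the complex scalar multiplication and the inner product.  The inner product is linear in the
  first argument.
\<close>

class complex_hilbert_space = banach +
  fixes scaleC :: "complex \<Rightarrow> 'a \<Rightarrow> 'a"  (infixr \<open>*\<^sub>C\<close> 75)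
    and cinner :: "'a \<Rightarrow> 'a \<Rightarrow> complex"
  assumes scaleC_add_right: "c *\<^sub>C (x + y) = c *\<^sub>C x + c *\<^sub>C y"
    and scaleC_add_left: "(c + d) *\<^sub>C x = c *\<^sub>C x + d *\<^sub>C x"
    and scaleC_scaleC: "c *\<^sub>C (d *\<^sub>C x) = (c * d) *\<^sub>C x"
    and scaleC_one: "1 *\<^sub>C x = x"
    and scaleR_scaleC: "scaleR r x = complex_of_real r *\<^sub>C x"
    and cinner_commute: "cinner x y = cnj (cinner y x)"
    and cinner_add_left: "cinner (x + y) z = cinner x z + cinner y z"
    and cinner_scaleC_left: "cinner (c *\<^sub>C x) y = c * cinner x y"
    and cinner_self_nonneg: "0 \<le> Re (cinner x x)"
    and cinner_eq_zero_iff: "cinner x x = 0 \<longleftrightarrow> x = 0"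
    and norm_eq_sqrt_cinner: "norm x = sqrt (Re (cinner x x))"

global_interpretation complex_vector: vector_space
  "scaleC :: complex \<Rightarrow> 'a \<Rightarrow> 'a::complex_hilbert_space"
  defines cspan = complex_vector.span
  by unfold_locales
    (rule scaleC_add_right scaleC_add_left scaleC_scaleC scaleC_one)+

definition infinite_dimensional_hilbert :: "'a::complex_hilbert_space itself \<Rightarrow> bool" where
  "infinite_dimensional_hilbert _ \<longleftrightarrow> \<not> (\<exists>B::'a set. finite B \<and> cspan B = UNIV)"

definition bounded_operator :: "('a::complex_hilbert_space \<Rightarrow> 'a) \<Rightarrow> bool" where
  "bounded_operator f \<longleftrightarrow> bounded_linear f \<and> (\<forall>c x. f (c *\<^sub>C x) = c *\<^sub>C f x)"

definition compact_operator :: "('a::complex_hilbert_space \<Rightarrow> 'a) \<Rightarrow> bool" where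
  "compact_operator f \<longleftrightarrow> bounded_operator f \<and> compact (closure (f ` cball 0 1))"

definition is_adjoint :: "('a::complex_hilbert_space \<Rightarrow> 'a) \<Rightarrow> ('a \<Rightarrow> 'a) \<Rightarrow> bool" where
  "is_adjoint f g \<longleftrightarrow> bounded_operator g \<and> (\<forall>x y. cinner (f x) y = cinner x (g y))"

definition unitary_operator :: "('a::complex_hilbert_space \<Rightarrow> 'a) \<Rightarrow> bool" where
  "unitary_operator u \<longleftrightarrow>
    bounded_operator u \<and> (\<exists>v. is_adjoint u v \<and> v \<circ> u = id \<and> u \<circ> v = id)"

definition unitary_group :: "('a::complex_hilbert_space \<Rightarrow> 'a) monoid" where
  "unitary_group = \<lparr>carrier = {u. unitary_operator u}, mult = (\<circ>), one = id\<rparr>"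

definition compact_unitaries :: "('a::complex_hilbert_space \<Rightarrow> 'a) set" where
  "compact_unitaries = {u \<in> carrier unitary_group. compact_operator (\<lambda>x. u x - x)}"

locale topological_group = group G for G (structure) +
  fixes T
  assumes topspace_eq_carrier: "topspace T = carrier G"
    and continuous_mult: "continuous_map (prod_topology T T) T (\<lambda>(x, y). x \<otimes> y)"
    and continuous_inv: "continuous_map T T (\<lambda>x. inv x)"

lemma unitary_operator_bounded: "unitary_operator u \<Longrightarrow> bounded_operator u"
  by (simp add: unitary_operator_def)

lemma bounded_operator_id: "bounded_operator id"
  by (simp add: bounded_operator_def bounded_linear_ident id_def)

lemma bounded_operator_comp:
  "bounded_operator f \<Longrightarrow> bounded_operator g \<Longrightarrow> bounded_operator (f \<circ> g)"
  by (auto simp: bounded_operator_def o_def intro: bounded_linear_compose)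

lemma is_adjoint_sym: "bounded_operator f \<Longrightarrow> is_adjoint f g \<Longrightarrow> is_adjoint g f"
  unfolding is_adjoint_def by (metis cinner_commute)

lemma unitary_operator_id: "unitary_operator id"
  unfolding unitary_operator_def is_adjoint_def using bounded_operator_id by auto

lemma unitary_operator_comp:
  assumes "unitary_operator u" "unitary_operator v"
  shows "unitary_operator (u \<circ> v)"
proof -
  obtain u' v' where *: "is_adjoint u u'" "u' \<circ> u = id" "u \<circ> u' = id"
    "is_adjoint v v'" "v' \<circ> v = id" "v \<circ> v' = id"
    using assms by (auto simp: unitary_operator_def)
  have "is_adjoint (u \<circ> v) (v' \<circ> u')"
    using * by (auto simp: is_adjoint_def intro: bounded_operator_comp)
  moreover have "(v' \<circ> u') \<circ> (u \<circ> v) = id" "(u \<circ> v) \<circ> (v' \<circ> u') = id"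
    using * by (auto simp: fun_eq_iff)
  ultimately show ?thesis
    unfolding unitary_operator_def
    using assms bounded_operator_comp unitary_operator_bounded by blast
qed

lemma unitary_operator_inverse:
  assumes "unitary_operator u"
  obtains v where "unitary_operator v" "v \<circ> u = id" "u \<circ> v = id"
proof -
  obtain v where v: "is_adjoint u v" "v \<circ> u = id" "u \<circ> v = id"
    using assms by (auto simp: unitary_operator_def)
  moreover have "unitary_operator v"
    unfolding unitary_operator_def
    using v is_adjoint_sym assms unitary_operator_bounded is_adjoint_def by blast
  ultimately show ?thesis using that by blast
qed

lemma unitary_operator_norm:
  assumes "unitary_operator u"
  shows "norm (u x) = norm x"
proof -
  obtain v where v: "is_adjoint u v" "v \<circ> u = id"
    using assms by (auto simp: unitary_operator_def)
  have "cinner (u x) (u x) = cinner x (v (u x))"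
    using v by (auto simp: is_adjoint_def)
  also have "v (u x) = x" using v by (metis comp_apply id_apply)
  finally show ?thesis by (simp add: norm_eq_sqrt_cinner)
qed

lemma compact_closure_subset:
  fixes S :: "'a::t2_space set"
  assumes "S \<subseteq> C" "compact C"
  shows "compact (closure S)"
proof -
  have "closure S \<subseteq> C"
    using assms by (simp add: closure_minimal compact_imp_closed)
  then show ?thesis
    using assms compact_Int_closed[of C "closure S"] by (simp add: Int_absorb1)
qed

lemma compact_operator_zero: "compact_operator (\<lambda>x. 0 :: 'a::complex_hilbert_space)"
proof -
  have "compact (closure ((\<lambda>x. 0 :: 'a) ` cball (0::'a) 1))"
    by (rule compact_closure_subset[of _ "{0}"]) auto
  then show ?thesis
    by (simp add: compact_operator_def bounded_operator_def bounded_linear_zero)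
qed

lemma compact_operator_left:
  assumes "compact_operator f" "bounded_operator g"
  shows "compact_operator (g \<circ> f)"
proof -
  have c: "compact (closure (f ` cball 0 1))"
    using assms by (auto simp: compact_operator_def)
  have "continuous_on (closure (f ` cball 0 1)) g"
    using assms(2) by (auto simp: bounded_operator_def intro: linear_continuous_on)
  then have "compact (g ` closure (f ` cball 0 1))"
    using c compact_continuous_image by blast
  moreover have "(g \<circ> f) ` cball 0 1 \<subseteq> g ` closure (f ` cball 0 1)"
    unfolding image_comp[symmetric] by (intro image_mono closure_subset)
  ultimately have "compact (closure ((g \<circ> f) ` cball 0 1))"
    using compact_closure_subset by blast
  then show ?thesis
    using assms bounded_operator_comp by (auto simp: compact_operator_def)
qed

lemma compact_operator_right:
  assumes "compact_operator f" "unitary_operator u"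
  shows "compact_operator (f \<circ> u)"
proof -
  have "(f \<circ> u) ` cball 0 1 \<subseteq> closure (f ` cball 0 1)"
    using closure_subset[of "f ` cball 0 1"] unitary_operator_norm[OF assms(2)] by auto
  then have "compact (closure ((f \<circ> u) ` cball 0 1))"
    using assms(1) compact_closure_subset by (auto simp: compact_operator_def)
  then show ?thesis
    using assms bounded_operator_comp unitary_operator_bounded
    by (auto simp: compact_operator_def)
qed

lemma compact_operator_add:
  assumes "compact_operator f" "compact_operator g"
  shows "compact_operator (\<lambda>x. f x + g x)"
proof -
  let ?F = "closure (f ` cball 0 1)" and ?G = "closure (g ` cball 0 1)"
  have "compact {x + y |x y. x \<in> ?F \<and> y \<in> ?G}"
    using assms by (intro compact_sums) (auto simp: compact_operator_def)
  moreover have "(\<lambda>x. f x + g x) ` cball 0 1 \<subseteq> {x + y |x y. x \<in> ?F \<and> y \<in> ?G}"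
    using closure_subset[of "f ` cball 0 1"] closure_subset[of "g ` cball 0 1"] by blast
  ultimately have "compact (closure ((\<lambda>x. f x + g x) ` cball 0 1))"
    using compact_closure_subset by blast
  then show ?thesis
    using assms
    by (auto simp: compact_operator_def bounded_operator_def scaleC_add_right
        intro: bounded_linear_add)
qed

lemma bounded_operator_uminus:
  assumes "bounded_operator f"
  shows "bounded_operator (\<lambda>x. - f x)"
  using assms
  by (auto simp: bounded_operator_def intro: bounded_linear_minus)

lemma group_unitary_group: "group (unitary_group :: ('a::complex_hilbert_space \<Rightarrow> 'a) monoid)"
proof (rule groupI)
  fix u :: "'a \<Rightarrow> 'a"
  assume "u \<in> carrier unitary_group"
  then have "unitary_operator u" by (simp add: unitary_group_def)
  then obtain v where "unitary_operator v" "v \<circ> u = id"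
    using unitary_operator_inverse by blast
  then show "\<exists>y\<in>carrier unitary_group. y \<otimes>\<^bsub>unitary_group\<^esub> u = \<one>\<^bsub>unitary_group\<^esub>"
    by (auto simp: unitary_group_def)
qed (auto simp: unitary_group_def unitary_operator_comp unitary_operator_id comp_assoc)

lemma unitary_group_inv:
  assumes "unitary_operator u"
  shows "unitary_operator (inv\<^bsub>unitary_group\<^esub> u)" "inv\<^bsub>unitary_group\<^esub> u \<circ> u = id"
    "u \<circ> inv\<^bsub>unitary_group\<^esub> u = id"
proof -
  interpret group "unitary_group :: ('a \<Rightarrow> 'a) monoid" by (rule group_unitary_group)
  have u: "u \<in> carrier unitary_group" using assms by (simp add: unitary_group_def)
  show "unitary_operator (inv\<^bsub>unitary_group\<^esub> u)"
    using inv_closed[OF u] by (simp add: unitary_group_def)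
  show "inv\<^bsub>unitary_group\<^esub> u \<circ> u = id"
    using l_inv[OF u] by (simp add: unitary_group_def)
  show "u \<circ> inv\<^bsub>unitary_group\<^esub> u = id"
    using r_inv[OF u] by (simp add: unitary_group_def)
qed

lemma normal_compact_unitaries:
  "compact_unitaries \<lhd> (unitary_group :: ('a::complex_hilbert_space \<Rightarrow> 'a) monoid)"
proof -
  let ?U = "unitary_group :: ('a \<Rightarrow> 'a) monoid"
  interpret group ?U by (rule group_unitary_group)
  have additive: "f (x - y) = f x - f y" if "bounded_operator f" for f :: "'a \<Rightarrow> 'a" and x y
    using that by (simp add: bounded_operator_def bounded_linear.linear linear_diff)
  have "subgroup compact_unitaries ?U"
  proof
    show "compact_unitaries \<subseteq> carrier ?U"
      by (auto simp: compact_unitaries_def)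
    show "\<one>\<^bsub>?U\<^esub> \<in> compact_unitaries"
      by (simp add: compact_unitaries_def unitary_group_def unitary_operator_id
          compact_operator_zero)
  next
    fix u v :: "'a \<Rightarrow> 'a"
    assume "u \<in> compact_unitaries" "v \<in> compact_unitaries"
    then have uv: "unitary_operator u" "compact_operator (\<lambda>x. u x - x)"
      "unitary_operator v" "compact_operator (\<lambda>x. v x - x)"
      by (auto simp: compact_unitaries_def unitary_group_def)
    have "compact_operator (\<lambda>x. ((\<lambda>x. u x - x) \<circ> v) x + (v x - x))"
      using uv by (intro compact_operator_add compact_operator_right)
    then show "u \<otimes>\<^bsub>?U\<^esub> v \<in> compact_unitaries"
      using uv by (simp add: compact_unitaries_def unitary_group_def unitary_operator_comp)
  next
    fix u :: "'a \<Rightarrow> 'a"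
    assume "u \<in> compact_unitaries"
    then have u: "unitary_operator u" "compact_operator (\<lambda>x. u x - x)"
      by (auto simp: compact_unitaries_def unitary_group_def)
    let ?v = "inv\<^bsub>?U\<^esub> u"
    note v = unitary_group_inv[OF u(1)]
    have "compact_operator ((\<lambda>x. - ?v x) \<circ> (\<lambda>x. u x - x))"
      using u v by (intro compact_operator_left bounded_operator_uminus unitary_operator_bounded)
    moreover have "(\<lambda>x. - ?v x) \<circ> (\<lambda>x. u x - x) = (\<lambda>x. ?v x - x)"
      using v by (auto simp: fun_eq_iff additive unitary_operator_bounded)
    ultimately show "?v \<in> compact_unitaries"
      using v by (simp add: compact_unitaries_def unitary_group_def)
  qed
  moreover have "w \<otimes>\<^bsub>?U\<^esub> u \<otimes>\<^bsub>?U\<^esub> inv\<^bsub>?U\<^esub> w \<in> compact_unitaries"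
    if "w \<in> carrier ?U" "u \<in> compact_unitaries" for w u :: "'a \<Rightarrow> 'a"
  proof -
    have u: "unitary_operator u" "compact_operator (\<lambda>x. u x - x)" and w: "unitary_operator w"
      using that by (auto simp: compact_unitaries_def unitary_group_def)
    let ?v = "inv\<^bsub>?U\<^esub> w"
    note v = unitary_group_inv[OF w]
    have "compact_operator (w \<circ> ((\<lambda>x. u x - x) \<circ> ?v))"
      using u v w by (intro compact_operator_left compact_operator_right unitary_operator_bounded)
    moreover have "w \<circ> ((\<lambda>x. u x - x) \<circ> ?v) = (\<lambda>x. (w \<circ> u \<circ> ?v) x - x)"
      using v w by (auto simp: fun_eq_iff additive unitary_operator_bounded)
    moreover have "unitary_operator (w \<circ> u \<circ> ?v)"
      using u v w by (intro unitary_operator_comp)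
    ultimately show ?thesis
      by (simp add: compact_unitaries_def) (simp add: unitary_group_def)
  qed
  ultimately show ?thesis
    by (simp add: normal_inv_iff)
qed

end

theory Submission
  imports Defs
begin

text \<open>
  Let \<open>\<phi>\<close> be a homomorphism on \<open>U(H)\<close> that kills \<open>compact_unitaries\<close>, and let \<open>W\<close> be the preimage of a
  symmetric neighbourhood \<open>V\<inverse>V\<close> of the identity.  Separability covers \<open>U(H)\<close> by countably many sets
  whose quotients lie in \<open>W\<close>, and it suffices to show that every unitary is a product of a fixed
  number of elements of \<open>W\<close>.

  Decompose \<open>H\<close> into infinitely many infinite-dimensional blocks.  By a diagonal argument, every
  unitary of some block \<open>A\<close> extends to an element of \<open>W\<close>; by the pigeonhole principle for an
  uncountable family, \<open>W\<close> contains a bilateral shift of infinite multiplicity supported on \<open>A\<close>.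
  Conjugating it and using a swindle, \<open>U(A)\<close> consists of bounded products.  An almost disjoint family
  of subspaces, corrected by a compact perturbation, moves \<open>A\<close> to a second block \<open>B\<close> containing its
  complement.  Every unitary is a product of two that fix infinite-dimensional subspaces, and
  \<open>U(A)\<close> and \<open>U(B)\<close> together move such a subspace onto the complement of \<open>A\<close>.
\<close>

section \<open>Orthonormal systems\<close>

text \<open>The normal subgroup has to do real work: \<open>U(H)\<close> itself is separable and
  Hausdorff in the strong operator topology, so its identity map is a non-trivial homomorphism.
  Compactness matters at one point, the tree argument: without it the two systems produced by the
  pigeonhole principle would still share finitely many vectors. As \<open>\<phi>\<close> is not
  continuous, \<open>W\<close> is not known to be a neighbourhood of anything. The countable cover
  can only be tested against objects too rich for it: direct sums over infinitely many blocks, or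
  families indexed by all sets of naturals. The number of factors must be known in advance, because
  \<open>V\<close> is chosen so small that products of that length avoid the image of a given
  unitary. It is 136: a conjugate inside the block costs 3, a quotient of two such shifts 6, two
  factors of this kind 12; the second half costs 2 + 12 + 2 = 16, moving a fixed subspace 16 + 12 =
  28, undoing the move 28 + 12 + 28 = 68, and two factors again 136.\<close>

lemma cinner_add_right: "cinner x (y + z) = cinner x y + cinner x z"
  by (metis cinner_add_left cinner_commute complex_cnj_add)

lemma cinner_scaleC_right: "cinner x (c *\<^sub>C y) = cnj c * cinner x y"
  by (metis cinner_scaleC_left cinner_commute complex_cnj_mult)

lemma cinner_zero_left [simp]: "cinner 0 y = 0"
  using cinner_add_left[of 0 0 y] by simp

lemma cinner_zero_right [simp]: "cinner y 0 = 0"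
  by (metis cinner_commute cinner_zero_left complex_cnj_zero)

lemma cinner_minus_left: "cinner (- x) y = - cinner x y"
  using cinner_add_left[of x "- x" y] by (simp add: eq_neg_iff_add_eq_0 add.commute)

lemma cinner_minus_right: "cinner x (- y) = - cinner x y"
  by (metis cinner_commute cinner_minus_left complex_cnj_minus)

lemma cinner_diff_left: "cinner (x - y) z = cinner x z - cinner y z"
  using cinner_add_left[of x "- y" z] by (simp add: cinner_minus_left)

lemma cinner_diff_right: "cinner x (y - z) = cinner x y - cinner x z"
  using cinner_add_right[of x y "- z"] by (simp add: cinner_minus_right)

lemma cinner_sum_left: "cinner (\<Sum>i\<in>F. f i) y = (\<Sum>i\<in>F. cinner (f i) y)"
  by (induction F rule: infinite_finite_induct) (auto simp: cinner_add_left)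

lemma cinner_sum_right: "cinner y (\<Sum>i\<in>F. f i) = (\<Sum>i\<in>F. cinner y (f i))"
  by (induction F rule: infinite_finite_induct) (auto simp: cinner_add_right)

lemma cinner_self: "cinner x x = complex_of_real ((norm x)\<^sup>2)"
proof -
  have "Im (cinner x x) = 0"
    using cinner_commute[of x x] by (metis cnj.simps(2) equal_neg_zero)
  then show ?thesis
    using cinner_self_nonneg[of x] by (simp add: norm_eq_sqrt_cinner complex_eq_iff)
qed

lemma norm_square_cinner: "(norm x)\<^sup>2 = Re (cinner x x)"
  by (simp add: cinner_self)

lemma cinner_eq_0_commute: "cinner x y = 0 \<longleftrightarrow> cinner y x = 0"
  by (metis cinner_commute complex_cnj_zero)

lemma norm_scaleC: "norm (c *\<^sub>C x) = cmod c * norm x"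
proof -
  have "cinner (c *\<^sub>C x) (c *\<^sub>C x) = complex_of_real ((cmod c * norm x)\<^sup>2)"
    using complex_norm_square[of c]
    by (simp add: cinner_scaleC_left cinner_scaleC_right cinner_self[of x] power_mult_distrib)
  then have "(norm (c *\<^sub>C x))\<^sup>2 = (cmod c * norm x)\<^sup>2"
    by (simp only: norm_square_cinner Re_complex_of_real)
  then show ?thesis
    by (simp add: power2_eq_iff_nonneg)
qed

definition orthonormal :: "('i \<Rightarrow> 'a::complex_hilbert_space) \<Rightarrow> bool" where
  "orthonormal e \<longleftrightarrow> (\<forall>i j. cinner (e i) (e j) = (if i = j then 1 else 0))"

lemma orthonormalD: "orthonormal e \<Longrightarrow> cinner (e i) (e j) = (if i = j then 1 else 0)"
  by (simp add: orthonormal_def)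

lemma orthonormal_norm: "orthonormal e \<Longrightarrow> norm (e i) = 1"
  by (simp add: orthonormal_def norm_eq_sqrt_cinner)

lemma orthonormal_nonzero: "orthonormal e \<Longrightarrow> e i \<noteq> 0"
  using orthonormal_norm[of e i] by force

lemma orthonormal_comp: "orthonormal e \<Longrightarrow> inj g \<Longrightarrow> orthonormal (\<lambda>i. e (g i))"
  by (simp add: orthonormal_def inj_eq)

lemma norm_orthonormal_sum:
  assumes "orthonormal e" "finite F"
  shows "(norm (\<Sum>i\<in>F. c i *\<^sub>C e i))\<^sup>2 = (\<Sum>i\<in>F. (cmod (c i))\<^sup>2)"
proof -
  have "cinner (\<Sum>i\<in>F. c i *\<^sub>C e i) (\<Sum>i\<in>F. c i *\<^sub>C e i)
      = (\<Sum>i\<in>F. \<Sum>j\<in>F. if i = j then cnj (c i) * c j else 0)"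
    by (simp add: cinner_sum_left cinner_sum_right cinner_scaleC_left cinner_scaleC_right
        orthonormalD[OF assms(1)] if_distrib if_distribR cong: if_cong)
       (simp add: assms(2) mult.commute)
  also have "\<dots> = (\<Sum>i\<in>F. complex_of_real ((cmod (c i))\<^sup>2))"
    using assms(2) complex_norm_square by (simp add: mult.commute)
  finally show ?thesis
    by (simp add: norm_square_cinner)
qed

lemma cinner_orthonormal_sum:
  assumes "orthonormal e" "finite F"
  shows "cinner (\<Sum>i\<in>F. c i *\<^sub>C e i) (e j) = (if j \<in> F then c j else 0)"
  using assms(2)
  by (simp add: cinner_sum_left cinner_scaleC_left orthonormalD[OF assms(1)] if_distrib cong: if_cong)

lemma pythagoras:
  assumes "cinner x y = 0"
  shows "(norm (x + y))\<^sup>2 = (norm x)\<^sup>2 + (norm y)\<^sup>2"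
  using assms cinner_eq_0_commute[of x y]
  by (simp add: norm_square_cinner cinner_add_left cinner_add_right)

lemma bessel:
  assumes "orthonormal e" "finite F"
  shows "(\<Sum>i\<in>F. (cmod (cinner x (e i)))\<^sup>2) \<le> (norm x)\<^sup>2"
proof -
  let ?p = "\<Sum>i\<in>F. cinner x (e i) *\<^sub>C e i"
  have "cinner (x - ?p) (e i) = 0" if "i \<in> F" for i
    using that by (simp add: cinner_diff_left cinner_orthonormal_sum[OF assms])
  then have "cinner (x - ?p) ?p = 0"
    by (simp add: cinner_sum_right cinner_scaleC_right)
  then have "(norm x)\<^sup>2 = (norm (x - ?p))\<^sup>2 + (norm ?p)\<^sup>2"
    using pythagoras[of "x - ?p" ?p] by simp
  then show ?thesis
    by (simp add: norm_orthonormal_sum[OF assms])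
qed

lemma Cauchy_Schwarz_cinner: "cmod (cinner x y) \<le> norm x * norm y"
proof (cases "y = 0")
  case False
  then have n: "norm y > 0" by simp
  define e where "e = (\<lambda>_::unit. complex_of_real (1 / norm y) *\<^sub>C y)"
  have "norm (e ()) = 1"
    using n norm_scaleC[of "complex_of_real (1 / norm y)" y] by (simp add: e_def norm_divide)
  then have "orthonormal e"
    by (simp add: orthonormal_def cinner_self)
  from bessel[OF this, of UNIV x] have "(cmod (cinner x (e ())))\<^sup>2 \<le> (norm x)\<^sup>2"
    by (simp add: UNIV_unit)
  then have "cmod (cinner x (e ())) \<le> norm x"
    by (simp add: abs_le_square_iff[symmetric])
  moreover have "cmod (cinner x (e ())) = cmod (cinner x y) / norm y"
    using n by (simp add: e_def cinner_scaleC_right norm_mult norm_divide)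
  ultimately show ?thesis
    using n by (simp add: field_simps)
qed simp

lemma cinner_scaleR_left: "cinner (r *\<^sub>R x) y = r *\<^sub>R cinner x y"
  by (simp add: scaleR_scaleC cinner_scaleC_left scaleR_conv_of_real)

lemma bounded_linear_cinner_left: "bounded_linear (\<lambda>x. cinner x y)"
  by (rule bounded_linear_intro[where K="norm y"])
     (auto simp: cinner_add_left cinner_scaleR_left Cauchy_Schwarz_cinner)

lemma cinner_suminf:
  assumes "summable f"
  shows "cinner (suminf f) y = (\<Sum>n. cinner (f n) y)"
  using bounded_linear.suminf[OF bounded_linear_cinner_left assms] by simp

section \<open>Square-summable expansions and partial isometries\<close>

lemma summable_orthonormal:
  fixes e :: "nat \<Rightarrow> 'a::complex_hilbert_space"
  assumes "orthonormal e" "summable (\<lambda>n. (cmod (c n))\<^sup>2)"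
  shows "summable (\<lambda>n. c n *\<^sub>C e n)"
  unfolding summable_Cauchy
proof (intro allI impI)
  fix r :: real assume r: "r > 0"
  then have "r\<^sup>2 > 0" by simp
  then obtain N where N: "\<And>m n. m \<ge> N \<Longrightarrow> norm (\<Sum>i=m..<n. (cmod (c i))\<^sup>2) < r\<^sup>2"
    using assms(2) unfolding summable_Cauchy by meson
  have "norm (\<Sum>i=m..<n. c i *\<^sub>C e i) < r" if "m \<ge> N" for m n
  proof -
    have "(norm (\<Sum>i=m..<n. c i *\<^sub>C e i))\<^sup>2 < r\<^sup>2"
      using N[OF that, of n] by (simp add: norm_orthonormal_sum[OF assms(1)] sum_nonneg)
    then show ?thesis
      using r by (meson less_eq_real_def power_less_imp_less_base)
  qed
  then show "\<exists>N. \<forall>m\<ge>N. \<forall>n. norm (\<Sum>i=m..<n. c i *\<^sub>C e i) < r"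
    by blast
qed

lemma summable_bessel:
  fixes e :: "nat \<Rightarrow> 'a::complex_hilbert_space"
  assumes "orthonormal e"
  shows "summable (\<lambda>n. (cmod (cinner x (e n)))\<^sup>2)"
  using bessel[OF assms] by (intro summableI_nonneg_bounded[where x="(norm x)\<^sup>2"]) auto

text \<open>For orthonormal sequences this is the partial isometry that takes \<open>e n\<close> to
  \<open>f n\<close> and kills the complement of \<open>e\<close>; \<open>transport e e\<close> is
  the orthogonal projection onto the closed span of \<open>e\<close>.\<close>

definition transport :: "(nat \<Rightarrow> 'a::complex_hilbert_space) \<Rightarrow> (nat \<Rightarrow> 'a) \<Rightarrow> 'a \<Rightarrow> 'a" where
  "transport e f x = (\<Sum>n. cinner x (e n) *\<^sub>C f n)"

context
  fixes e f :: "nat \<Rightarrow> 'a::complex_hilbert_space"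
  assumes e: "orthonormal e" and f: "orthonormal f"
begin

lemma summable_transport: "summable (\<lambda>n. cinner x (e n) *\<^sub>C f n)"
  by (intro summable_orthonormal[OF f] summable_bessel[OF e])

lemma cinner_transport: "cinner (transport e f x) y = (\<Sum>n. cinner x (e n) * cinner (f n) y)"
  unfolding transport_def by (simp add: cinner_suminf[OF summable_transport] cinner_scaleC_left)

lemma cinner_transport_basis: "cinner (transport e f x) (f m) = cinner x (e m)"
proof -
  have "(\<lambda>n. cinner x (e n) * cinner (f n) (f m)) = (\<lambda>n. if n = m then cinner x (e m) else 0)"
    by (auto simp: orthonormalD[OF f])
  then show ?thesis
    using suminf_finite[of "{m}" "\<lambda>n. if n = m then cinner x (e m) else 0"]
    by (simp add: cinner_transport)
qed

lemma transport_basis: "transport e f (e m) = f m"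
proof -
  have "(\<lambda>n. cinner (e m) (e n) *\<^sub>C f n) = (\<lambda>n. if n = m then f m else 0)"
    by (auto simp: orthonormalD[OF e] scaleC_one)
  then show ?thesis
    using suminf_finite[of "{m}" "\<lambda>n. if n = m then f m else 0"]
    by (simp add: transport_def)
qed

lemma transport_add: "transport e f (x + y) = transport e f x + transport e f y"
  by (simp add: transport_def cinner_add_left scaleC_add_left suminf_add summable_transport)

lemma norm_transport_le: "norm (transport e f x) \<le> norm x"
proof -
  have "(\<lambda>n. norm (\<Sum>i<n. cinner x (e i) *\<^sub>C f i)) \<longlonglongrightarrow> norm (transport e f x)"
    unfolding transport_def by (intro tendsto_norm summable_LIMSEQ summable_transport)
  moreover have "norm (\<Sum>i<n. cinner x (e i) *\<^sub>C f i) \<le> norm x" for n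
  proof -
    have "(norm (\<Sum>i<n. cinner x (e i) *\<^sub>C f i))\<^sup>2 \<le> (norm x)\<^sup>2"
      using bessel[OF e, of "{..<n}"] by (simp add: norm_orthonormal_sum[OF f])
    then show ?thesis
      by (simp add: abs_le_square_iff[symmetric])
  qed
  ultimately show ?thesis
    by (meson LIMSEQ_le_const2)
qed

lemma transport_scaleC: "transport e f (c *\<^sub>C x) = c *\<^sub>C transport e f x"
proof -
  have "bounded_linear (\<lambda>y. c *\<^sub>C y :: 'a)"
    by (rule bounded_linear_intro[where K="cmod c"])
       (auto simp: scaleC_add_right scaleR_scaleC scaleC_scaleC mult.commute norm_scaleC)
  from bounded_linear.suminf[OF this summable_transport]
  show ?thesis
    by (simp add: transport_def cinner_scaleC_left scaleC_scaleC)
qed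

lemma bounded_operator_transport: "bounded_operator (transport e f)"
  unfolding bounded_operator_def
proof (intro conjI allI)
  show "bounded_linear (transport e f)"
    by (rule bounded_linear_intro[where K=1])
       (auto simp: transport_add transport_scaleC scaleR_scaleC norm_transport_le)
qed (rule transport_scaleC)

end

lemma cinner_transport_swap:
  assumes "orthonormal e" "orthonormal f"
  shows "cinner (transport e f x) y = cinner x (transport f e y)"
proof -
  have "cinner x (transport f e y) = cnj (cinner (transport f e y) x)"
    by (rule cinner_commute)
  also have "\<dots> = cnj (\<Sum>n. cinner y (f n) * cinner (e n) x)"
    by (simp add: cinner_transport[OF assms(2,1)])
  also have "\<dots> = (\<Sum>n. cnj (cinner y (f n) * cinner (e n) x))"
    using bounded_linear.summable[OF bounded_linear_cinner_left summable_transport[OF assms(2,1)], of y x]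
    by (intro bounded_linear.suminf[OF bounded_linear_cnj]) (simp add: cinner_scaleC_left)
  also have "\<dots> = (\<Sum>n. cinner x (e n) * cinner (f n) y)"
    by (simp add: cinner_commute[symmetric] mult.commute)
  finally show ?thesis
    by (simp add: cinner_transport[OF assms])
qed

lemma transport_transport:
  assumes "orthonormal e" "orthonormal f"
  shows "transport f g (transport e f x) = transport e g x"
  unfolding transport_def[of f g] cinner_transport_basis[OF assms] by (simp add: transport_def)

text \<open>\<open>HOL-Algebra\<close> claims the notation \<open>inv\<close> for groups.\<close>

abbreviation uinv :: "('a \<Rightarrow> 'b) \<Rightarrow> 'b \<Rightarrow> 'a" where
  "uinv u \<equiv> inv_into UNIV u"

section \<open>Orthogonal complements and their bases\<close>

definition oc :: "'a::complex_hilbert_space set \<Rightarrow> 'a set" where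
  "oc S = {x. \<forall>s\<in>S. cinner x s = 0}"

lemma ocI: "(\<And>s. s \<in> S \<Longrightarrow> cinner x s = 0) \<Longrightarrow> x \<in> oc S"
  by (simp add: oc_def)

lemma ocD: "x \<in> oc S \<Longrightarrow> s \<in> S \<Longrightarrow> cinner x s = 0"
  by (simp add: oc_def)

lemma ocD': "x \<in> oc S \<Longrightarrow> s \<in> S \<Longrightarrow> cinner s x = 0"
  using cinner_eq_0_commute ocD by blast

lemma subspace_oc: "complex_vector.subspace (oc S)"
  by (simp add: complex_vector.subspace_def oc_def cinner_add_left cinner_scaleC_left)

lemma oc_diff: "x \<in> oc S \<Longrightarrow> y \<in> oc S \<Longrightarrow> x - y \<in> oc S"
  by (simp add: oc_def cinner_diff_left)

lemma oc_antimono: "S \<subseteq> T \<Longrightarrow> oc T \<subseteq> oc S"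
  by (auto simp: oc_def)

lemma subset_oc_oc: "S \<subseteq> oc (oc S)"
  by (auto intro!: ocI dest: ocD')

lemma oc_Un: "oc (S \<union> T) = oc S \<inter> oc T"
  by (auto simp: oc_def)

lemma oc_empty [simp]: "oc {} = UNIV"
  by (simp add: oc_def)

lemma oc_self: "x \<in> S \<Longrightarrow> x \<in> oc S \<Longrightarrow> x = 0"
  using ocD cinner_eq_zero_iff by blast

lemma oc_self_closure: "x \<in> oc S \<Longrightarrow> x \<in> oc (oc S) \<Longrightarrow> x = 0"
  by (rule oc_self)

lemma cinner_eqI: "(\<And>y. cinner x y = cinner x' y) \<Longrightarrow> x = x'"
  using cinner_eq_zero_iff[of "x - x'"] by (simp add: cinner_diff_left)

text \<open>A closed subspace is described by vectors \<open>S\<close> to which it is orthogonal,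
  because its unitary group is then \<open>fixator S\<close>. Completeness is stated as maximality;
  the expansion of vectors follows in \<open>transport_self\<close>. The index type is left free so
  that bases can be assembled along sums and products of types.\<close>

definition onb :: "'a::complex_hilbert_space set \<Rightarrow> ('i \<Rightarrow> 'a) \<Rightarrow> bool" where
  "onb S e \<longleftrightarrow> orthonormal e \<and> range e \<subseteq> oc S \<and> (\<forall>x\<in>oc S. x \<in> oc (range e) \<longrightarrow> x = 0)"

lemma onb_orthonormal: "onb S e \<Longrightarrow> orthonormal e"
  by (simp add: onb_def)

lemma onb_in_oc: "onb S e \<Longrightarrow> e i \<in> oc S"
  by (auto simp: onb_def)

lemma onb_eq_0: "onb S e \<Longrightarrow> x \<in> oc S \<Longrightarrow> x \<in> oc (range e) \<Longrightarrow> x = 0"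
  by (simp add: onb_def)

lemma onb_reindex:
  assumes "onb S e" "bij g"
  shows "onb S (\<lambda>i. e (g i))"
proof -
  have "range (\<lambda>i. e (g i)) = range e"
    using assms(2) by (metis bij_def image_image)
  then show ?thesis
    using assms by (auto simp: onb_def bij_def intro: orthonormal_comp)
qed

lemma ex_enum:
  assumes "infinite (UNIV :: 'i::countable set)"
  obtains g :: "nat \<Rightarrow> 'i::countable" where "bij g"
  using bij_betw_from_nat_into[of "UNIV :: 'i set"] assms by blast

lemma onb_restrict:
  assumes "onb S e" "inj g" "T = S \<union> e ` (- range g)"
  shows "onb T (\<lambda>i. e (g i))"
  unfolding onb_def
proof (intro conjI ballI impI)
  note o = onb_orthonormal[OF assms(1)]
  show "orthonormal (\<lambda>i. e (g i))"
    using o assms(2) by (rule orthonormal_comp)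
  have "cinner (e (g i)) (e j) = 0" if "j \<notin> range g" for i j
    using that by (auto simp: orthonormalD[OF o])
  then show "range (\<lambda>i. e (g i)) \<subseteq> oc T"
    using onb_in_oc[OF assms(1)] unfolding assms(3) oc_Un by (auto intro: ocI)
  fix x assume x: "x \<in> oc T" "x \<in> oc (range (\<lambda>i. e (g i)))"
  have "cinner x (e j) = 0" for j
    using x ocD[of x "e ` (- range g)" "e j"] ocD[OF x(2)] by (cases "j \<in> range g") (auto simp: assms(3) oc_Un)
  then show "x = 0"
    using x(1) by (intro onb_eq_0[OF assms(1)]) (auto simp: assms(3) oc_Un intro: ocI)
qed

lemma onb_sum:
  assumes "onb (S \<union> range c) d" "orthonormal c" "range c \<subseteq> oc S"
  shows "onb S (case_sum c d)"
  unfolding onb_def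
proof (intro conjI ballI impI)
  have d: "d i \<in> oc S" "d i \<in> oc (range c)" for i
    using onb_in_oc[OF assms(1)] by (auto simp: oc_Un)
  then have "cinner (d i) (c j) = 0" "cinner (c j) (d i) = 0" for i j
    using ocD ocD' by blast+
  then show "orthonormal (case_sum c d)"
    using onb_orthonormal[OF assms(1)] assms(2)
    by (auto simp: orthonormal_def split: sum.splits)
  show "range (case_sum c d) \<subseteq> oc S"
    using d assms(3) by (force split: sum.splits)
  fix x assume x: "x \<in> oc S" "x \<in> oc (range (case_sum c d))"
  have "cinner x (case_sum c d i) = 0" for i
    using x(2) by (auto dest: ocD)
  from this[of "Inl _"] this[of "Inr _"] show "x = 0"
    using x(1) by (intro onb_eq_0[OF assms(1)]) (auto simp: oc_Un intro!: ocI)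
qed

text \<open>The remainder \<open>x - transport e e x\<close> stays in \<open>oc S\<close> and is
  orthogonal to every \<open>e n\<close>, so maximality makes it vanish.\<close>

lemma transport_self:
  assumes "onb S e" "x \<in> oc S"
  shows "transport e e x = x"
proof -
  note o = onb_orthonormal[OF assms(1)]
  have "cinner (transport e e x) s = 0" if "s \<in> S" for s
    using ocD[OF onb_in_oc[OF assms(1)] that] by (simp add: cinner_transport[OF o o])
  then have "x - transport e e x \<in> oc S"
    using assms(2) by (intro oc_diff) (auto intro: ocI)
  moreover have "x - transport e e x \<in> oc (range e)"
    by (auto intro!: ocI simp: cinner_diff_left cinner_transport_basis[OF o o])
  ultimately show ?thesis
    using onb_eq_0[OF assms(1)] by force
qed

lemma transport_in_oc:
  assumes "orthonormal e" "onb S f"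
  shows "transport e f x \<in> oc S"
  using ocD[OF onb_in_oc[OF assms(2)]]
  by (auto intro!: ocI simp: cinner_transport[OF assms(1) onb_orthonormal[OF assms(2)]])

text \<open>Every \<open>x\<close> in \<open>oc S\<close> is the sum of its expansion, so a vector
  orthogonal to the basis is orthogonal to \<open>x\<close>. The double complement plays the part of
  the closed span throughout.\<close>

lemma oc_range_onb:
  fixes e :: "'i::countable \<Rightarrow> 'a::complex_hilbert_space"
  assumes "onb S e" "infinite (UNIV :: 'i set)"
  shows "oc (range e) = oc (oc S)"
proof
  show "oc (oc S) \<subseteq> oc (range e)"
    using onb_in_oc[OF assms(1)] by (intro oc_antimono) auto
  obtain g :: "nat \<Rightarrow> 'i" where g: "bij g"
    using ex_enum assms(2) by blast
  define e' where "e' = (\<lambda>i. e (g i))"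
  have e': "onb S e'"
    unfolding e'_def using assms(1) g by (rule onb_reindex)
  note o = onb_orthonormal[OF e']
  show "oc (range e) \<subseteq> oc (oc S)"
  proof (intro subsetI ocI)
    fix y x assume y: "y \<in> oc (range e)" and x: "x \<in> oc S"
    have "cinner (e' n) y = 0" for n
      using y by (auto simp: e'_def dest: ocD')
    then have "cinner (transport e' e' x) y = 0"
      by (simp add: cinner_transport[OF o o])
    then show "cinner y x = 0"
      using transport_self[OF e' x] cinner_eq_0_commute by auto
  qed
qed

subsection \<open>Pointwise stabilizers\<close>

lemma bounded_operator_additive:
  assumes "bounded_operator f"
  shows "f (x + y) = f x + f y" "f (x - y) = f x - f y" "f 0 = 0" "f (c *\<^sub>C x) = c *\<^sub>C f x"
  using assms
  by (simp_all add: bounded_operator_def bounded_linear.linear linear_add linear_diff linear_0)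

lemmas unitary_additive = bounded_operator_additive[OF unitary_operator_bounded]

lemma unitary_inv:
  assumes "unitary_operator u"
  shows "unitary_operator (uinv u)" "uinv u (u x) = x" "u (uinv u x) = x"
proof -
  obtain v where v: "unitary_operator v" "v \<circ> u = id" "u \<circ> v = id"
    using unitary_operator_inverse[OF assms] by blast
  then have "uinv u = v"
    by (metis inv_unique_comp)
  with v show "unitary_operator (uinv u)" "uinv u (u x) = x" "u (uinv u x) = x"
    by (simp_all add: pointfree_idE)
qed

lemma unitary_inj: "unitary_operator u \<Longrightarrow> inj u"
  by (metis injI unitary_inv(2))

lemma unitary_inv_inv: "unitary_operator u \<Longrightarrow> uinv (uinv u) = u"
  by (metis bijI inv_inv_eq surjI unitary_inj unitary_inv(3))

lemma cinner_unitary_inv: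
  assumes "unitary_operator u"
  shows "cinner (u x) y = cinner x (uinv u y)"
proof -
  obtain v where v: "\<And>x y. cinner (u x) y = cinner x (v y)" "v \<circ> u = id" "u \<circ> v = id"
    using assms by (auto simp: unitary_operator_def is_adjoint_def)
  then have "uinv u = v"
    by (metis inv_unique_comp)
  with v show ?thesis by simp
qed

lemma cinner_unitary: "unitary_operator u \<Longrightarrow> cinner (u x) (u y) = cinner x y"
  by (simp add: cinner_unitary_inv unitary_inv)

lemma orthonormal_unitary: "unitary_operator u \<Longrightarrow> orthonormal e \<Longrightarrow> orthonormal (\<lambda>i. u (e i))"
  by (simp add: orthonormal_def cinner_unitary)

text \<open>By \<open>fixator_oc\<close> and \<open>fixator_oc_oc\<close> this is the unitary group
  of the space \<open>oc S\<close>, each element being extended by the identity.\<close>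

definition fixator :: "'a::complex_hilbert_space set \<Rightarrow> ('a \<Rightarrow> 'a) set" where
  "fixator S = {u. unitary_operator u \<and> (\<forall>s\<in>S. u s = s)}"

lemma fixatorI: "unitary_operator u \<Longrightarrow> (\<And>s. s \<in> S \<Longrightarrow> u s = s) \<Longrightarrow> u \<in> fixator S"
  by (simp add: fixator_def)

lemma fixator_unitary: "u \<in> fixator S \<Longrightarrow> unitary_operator u"
  by (simp add: fixator_def)

lemma fixatorD: "u \<in> fixator S \<Longrightarrow> s \<in> S \<Longrightarrow> u s = s"
  by (simp add: fixator_def)

lemma fixator_empty [simp]: "fixator {} = {u. unitary_operator u}"
  by (simp add: fixator_def)

lemma fixator_id [simp]: "id \<in> fixator S"
  by (simp add: fixator_def unitary_operator_id)

lemma fixator_comp: "u \<in> fixator S \<Longrightarrow> v \<in> fixator S \<Longrightarrow> u \<circ> v \<in> fixator S"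
  by (simp add: fixator_def unitary_operator_comp)

lemma fixator_inv: "u \<in> fixator S \<Longrightarrow> uinv u \<in> fixator S"
  by (auto simp: fixator_def unitary_inv) (metis unitary_inv(2))

lemma fixator_antimono: "S \<subseteq> T \<Longrightarrow> fixator T \<subseteq> fixator S"
  by (auto simp: fixator_def)

lemma fixator_Un: "fixator (S \<union> T) = fixator S \<inter> fixator T"
  by (auto simp: fixator_def)

lemma fixator_oc:
  assumes "u \<in> fixator S" "x \<in> oc S"
  shows "u x \<in> oc S"
  using assms fixator_inv[OF assms(1)]
  by (auto intro!: ocI simp: cinner_unitary_inv[OF fixator_unitary] fixatorD ocD)

text \<open>No limit is taken. The vector \<open>u x - x\<close> is orthogonal to \<open>S\<close>
  since \<open>uinv u\<close> fixes \<open>S\<close>, and it lies in \<open>oc (oc S)\<close> since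
  \<open>uinv u\<close> preserves \<open>oc S\<close>; hence it is orthogonal to itself.\<close>

lemma fixator_oc_oc:
  assumes "u \<in> fixator S"
  shows "u \<in> fixator (oc (oc S))"
proof (rule fixatorI)
  show u: "unitary_operator u" using assms by (rule fixator_unitary)
  fix x assume x: "x \<in> oc (oc S)"
  have i: "uinv u \<in> fixator S" using assms by (rule fixator_inv)
  have "u x - x \<in> oc S"
    using fixatorD[OF i]
    by (auto intro!: ocI simp: cinner_diff_left cinner_unitary_inv[OF u])
  moreover have "u x \<in> oc (oc S)"
    using ocD[OF x fixator_oc[OF i]] by (auto intro!: ocI simp: cinner_unitary_inv[OF u])
  ultimately have "u x - x = 0"
    using x by (blast intro: oc_self_closure oc_diff)
  then show "u x = x" by simp
qed

lemma unitary_eqI: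
  assumes "unitary_operator u" "unitary_operator v" "\<And>x. x \<in> S \<Longrightarrow> u x = v x" "oc S \<subseteq> {0}"
  shows "u = v"
proof
  fix x
  have "uinv v \<circ> u \<in> fixator S"
    using assms by (auto intro!: fixatorI unitary_operator_comp simp: unitary_inv)
  then have "uinv v \<circ> u \<in> fixator (oc (oc S))"
    by (rule fixator_oc_oc)
  moreover have "x \<in> oc (oc S)"
    using assms(4) by (intro ocI) auto
  ultimately have "uinv v (u x) = x"
    by (auto dest: fixatorD)
  then show "u x = v x"
    by (metis assms(2) unitary_inv(3))
qed

text \<open>The supports are disjoint: \<open>u\<close> acts on \<open>oc S\<close> and is the
  identity on \<open>oc (oc S)\<close>, \<open>v\<close> the other way round, and \<open>S\<close>
  together with \<open>oc S\<close> is total.\<close>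

lemma fixator_commute:
  fixes e :: "'i::countable \<Rightarrow> 'a::complex_hilbert_space"
  assumes "onb S e" "infinite (UNIV :: 'i set)" "u \<in> fixator S" "v \<in> fixator (range e)"
  shows "u (v x) = v (u x)"
proof -
  have u: "u \<in> fixator (oc (range e))"
    using fixator_oc_oc[OF assms(3)] oc_range_onb[OF assms(1,2)] by simp
  have v: "v \<in> fixator (oc (oc (range e)))"
    using fixator_oc_oc[OF assms(4)] .
  have "u \<circ> v = v \<circ> u"
  proof (rule unitary_eqI[where S="S \<union> oc S"])
    show "unitary_operator (u \<circ> v)" "unitary_operator (v \<circ> u)"
      using assms(3,4) fixator_unitary unitary_operator_comp by blast+
    show "oc (S \<union> oc S) \<subseteq> {0}"
      using oc_self_closure by (auto simp: oc_Un)
    fix x assume "x \<in> S \<union> oc S"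
    then consider "x \<in> S" "x \<in> oc (range e)" | "x \<in> oc (oc (range e))" "x \<in> oc S"
      using oc_range_onb[OF assms(1,2)] subset_oc_oc[of S] subset_oc_oc[of "oc S"] by auto
    then show "(u \<circ> v) x = (v \<circ> u) x"
    proof cases
      case 1
      then show ?thesis
        using fixatorD[OF u] fixator_oc[OF assms(4)] by simp
    next
      case 2
      then have "u x \<in> oc (oc (range e))"
        using fixator_oc[OF assms(3)] oc_range_onb[OF assms(1,2)] subset_oc_oc[of "oc S"] by auto
      with 2 show ?thesis
        using fixatorD[OF v] by simp
    qed
  qed
  then show ?thesis
    by (auto simp: fun_eq_iff)
qed

section \<open>Unitaries given by a change of basis\<close>

lemma bounded_operator_add:
  assumes "bounded_operator f" "bounded_operator g"
  shows "bounded_operator (\<lambda>x. f x + g x)"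
  using assms by (auto simp: bounded_operator_def scaleC_add_right intro: bounded_linear_add)

lemma bounded_operator_diff:
  assumes "bounded_operator f" "bounded_operator g"
  shows "bounded_operator (\<lambda>x. f x - g x)"
  using bounded_operator_add[OF assms(1) bounded_operator_uminus[OF assms(2)]] by simp

text \<open>In the decomposition of the identity into the projection onto \<open>oc S\<close> and
  its complement, the projection is replaced by \<open>transport e f\<close>. Both bases span
  \<open>oc S\<close>, so their projections agree; this makes \<open>U f e\<close> both the inverse
  and the adjoint of \<open>U e f\<close>.\<close>

lemma ex_unitary_nat:
  fixes e f :: "nat \<Rightarrow> 'a::complex_hilbert_space"
  assumes e: "onb S e" and f: "onb S f"
  shows "\<exists>u\<in>fixator S. \<forall>i. u (e i) = f i"
proof -
  note oe = onb_orthonormal[OF e] and of = onb_orthonormal[OF f]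
  define U where "U = (\<lambda>e f :: nat \<Rightarrow> 'a. \<lambda>x. x - transport e e x + transport e f x)"
  have P: "transport e e x = transport f f x" for x
  proof (rule cinner_eqI)
    fix y
    have "cinner (transport f f x) y = cinner (transport e e (transport f f x)) y"
      by (simp add: transport_self[OF e transport_in_oc[OF of f]])
    also have "\<dots> = cinner x (transport f f (transport e e y))"
      by (simp add: cinner_transport_swap[OF oe oe] cinner_transport_swap[OF of of])
    also have "\<dots> = cinner x (transport e e y)"
      by (simp add: transport_self[OF f transport_in_oc[OF oe e]])
    finally show "cinner (transport e e x) y = cinner (transport f f x) y"
      by (simp add: cinner_transport_swap[OF oe oe])
  qed
  have b: "bounded_operator (U a b)" if "orthonormal a" "orthonormal b" for a b
    unfolding U_def using bounded_operator_id that
    by (intro bounded_operator_add bounded_operator_diff bounded_operator_transport)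
       (auto simp: id_def)
  have inverse: "U b a (U a b x) = x"
    if "orthonormal a" "orthonormal b" "\<And>x. transport a a x = transport b b x" for a b x
  proof -
    note add = bounded_operator_additive[OF bounded_operator_transport]
    have "transport b b (U a b x) = transport a b x"
      using that by (simp add: U_def add transport_transport)
    moreover have "transport b a (U a b x) = transport a a x"
      using that by (simp add: U_def add transport_transport)
    ultimately show ?thesis
      by (simp add: U_def)
  qed
  have adj: "cinner (U e f x) y = cinner x (U f e y)" for x y
    by (simp add: U_def cinner_add_left cinner_diff_left cinner_add_right cinner_diff_right
        cinner_transport_swap[OF oe of] cinner_transport_swap[OF of of] P)
  have "unitary_operator (U e f)"
    unfolding unitary_operator_def is_adjoint_def
    using b[OF oe of] b[OF of oe] adj inverse[OF oe of P] inverse[OF of oe P[symmetric]]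
    by (auto intro!: exI[of _ "U f e"] simp: fun_eq_iff)
  moreover have "U e f s = s" if "s \<in> S" for s
    using that ocD'[OF onb_in_oc[OF e]] by (simp add: U_def transport_def)
  moreover have "U e f (e i) = f i" for i
    by (simp add: U_def transport_basis oe of)
  ultimately show ?thesis
    by (auto intro!: bexI[of _ "U e f"] fixatorI)
qed

lemma ex_unitary:
  fixes e f :: "'i::countable \<Rightarrow> 'a::complex_hilbert_space"
  assumes "onb S e" "onb S f" "infinite (UNIV :: 'i set)"
  obtains u where "u \<in> fixator S" "\<And>i. u (e i) = f i"
proof -
  obtain g :: "nat \<Rightarrow> 'i" where g: "bij g"
    using ex_enum assms(3) by blast
  obtain u where u: "u \<in> fixator S" "\<And>i. u (e (g i)) = f (g i)"
    using ex_unitary_nat[OF onb_reindex[OF assms(1) g] onb_reindex[OF assms(2) g]] by auto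
  have "u (e i) = f i" for i
    using u(2)[of "uinv g i"] g by (simp add: bij_is_surj surj_f_inv_f)
  with u(1) that show ?thesis by blast
qed

subsection \<open>Existence of orthonormal bases\<close>

text \<open>At each stage the earlier terms form a finite set, so solvability against finite sets is
  enough for dependent choice.\<close>

lemma sequence_choice:
  assumes "\<And>F. finite F \<Longrightarrow> \<forall>h\<in>F. Q h \<Longrightarrow> \<exists>x. Q x \<and> (\<forall>h\<in>F. R h x)"
  obtains x :: "nat \<Rightarrow> 'a" where "\<And>n. Q (x n)" "\<And>j n. j < n \<Longrightarrow> R (x j) (x n)"
proof -
  have "\<exists>f. \<forall>n::nat. Q (f n) \<and> (\<forall>j<n. R (f j) (f n))"
  proof (rule dependent_wellorder_choice)
    fix n and f :: "nat \<Rightarrow> 'a"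
    assume *: "\<And>m. m < n \<Longrightarrow> Q (f m) \<and> (\<forall>j<m. R (f j) (f m))"
    show "\<exists>r. Q r \<and> (\<forall>j<n. R (f j) r)"
      using assms[of "f ` {..<n}"] * by auto
  qed simp
  with that show ?thesis by blast
qed

lemma orthonormal_normalize:
  assumes "\<And>i j. i \<noteq> j \<Longrightarrow> cinner (w i) (w j) = 0" "\<And>i. w i \<noteq> 0"
  shows "orthonormal (\<lambda>i. complex_of_real (1 / norm (w i)) *\<^sub>C w i)"
  unfolding orthonormal_def
  using assms
  by (auto simp: cinner_scaleC_left cinner_scaleC_right cinner_self[of "w _"] power2_eq_square)

text \<open>One more orthogonality condition is met by grouping the sequence into disjoint pairs:
  the span of each pair contains a non-zero vector orthogonal to \<open>f\<close>, and vectors from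
  different pairs remain orthogonal.\<close>

lemma orthonormal_oc_finite:
  fixes c :: "nat \<Rightarrow> 'a::complex_hilbert_space"
  assumes "complex_vector.subspace M" "orthonormal c" "range c \<subseteq> M" "finite F"
  shows "\<exists>d :: nat \<Rightarrow> 'a. orthonormal d \<and> range d \<subseteq> M \<inter> oc F"
  using assms(4)
proof (induction F rule: finite_induct)
  case (insert f F)
  then obtain d :: "nat \<Rightarrow> 'a" where d: "orthonormal d" "range d \<subseteq> M \<inter> oc F"
    by blast
  have sub: "complex_vector.subspace (M \<inter> oc F)"
    using assms(1) subspace_oc by (rule complex_vector.subspace_inter)
  define w where "w n = (if cinner (d (2*n)) f = 0 then d (2*n)
    else cinner (d (2*n+1)) f *\<^sub>C d (2*n) - cinner (d (2*n)) f *\<^sub>C d (2*n+1))" for n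
  note simps = cinner_scaleC_left cinner_scaleC_right cinner_diff_left cinner_diff_right
    orthonormalD[OF d(1)]
  have parity: "2 * m \<noteq> Suc (2 * n)" "Suc (2 * n) \<noteq> 2 * m" for m n :: nat
    by presburger+
  have "cinner (w m) (w n) = 0" if "m \<noteq> n" for m n
    using that by (auto simp: w_def simps parity)
  moreover have "w n \<noteq> 0" for n
  proof (cases "cinner (d (2*n)) f = 0")
    case False
    then have "cinner (w n) (d (2*n+1)) \<noteq> 0"
      by (simp add: w_def simps parity)
    then show ?thesis by force
  qed (use orthonormal_nonzero[OF d(1)] in \<open>simp add: w_def\<close>)
  ultimately have "orthonormal (\<lambda>n. complex_of_real (1 / norm (w n)) *\<^sub>C w n)" (is "orthonormal ?e")
    by (rule orthonormal_normalize)
  moreover have w: "w n \<in> M \<inter> oc F" for n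
  proof -
    have dn: "d n \<in> M \<inter> oc F" for n
      using d(2) by blast
    show ?thesis
      unfolding w_def using dn
      by (simp only: complex_vector.subspace_diff[OF sub] complex_vector.subspace_scale[OF sub]
          split: if_split) simp
  qed
  have "?e n \<in> M \<inter> oc (insert f F)" for n
  proof -
    have "?e n \<in> M \<inter> oc F"
      using w sub complex_vector.subspace_scale by blast
    moreover have "cinner (w n) f = 0"
      by (simp add: w_def simps)
    ultimately show ?thesis
      by (auto simp: oc_def cinner_scaleC_left)
  qed
  ultimately show ?case
    by blast
qed (use assms in auto)

lemma subspace_pick:
  fixes c :: "nat \<Rightarrow> 'a::complex_hilbert_space"
  assumes "complex_vector.subspace M" "orthonormal c" "range c \<subseteq> M" "finite F"
  shows "\<exists>x\<in>M. norm x = 1 \<and> x \<in> oc F"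
proof -
  obtain d :: "nat \<Rightarrow> 'a" where "orthonormal d" "range d \<subseteq> M \<inter> oc F"
    using orthonormal_oc_finite[OF assms] by blast
  then show ?thesis
    using orthonormal_norm[of d 0] by (intro bexI[of _ "d 0"]) auto
qed

lemma orthonormal_set_countable:
  fixes B :: "'a::complex_hilbert_space set"
  assumes "separable_space (euclidean :: 'a topology)"
    and "\<And>x y. x \<in> B \<Longrightarrow> y \<in> B \<Longrightarrow> cinner x y = (if x = y then 1 else 0)"
  shows "countable B"
proof -
  obtain D :: "'a set" where D: "countable D" "closure D = UNIV"
    using assms(1) by (auto simp: separable_space_def)
  have "\<exists>d\<in>D. dist d x < 1 / 2" for x
    using D(2) closure_approachable[of x D] by (metis UNIV_I half_gt_zero zero_less_one)
  then obtain d where d: "\<And>x. d x \<in> D" "\<And>x. dist (d x) x < 1 / 2"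
    by metis
  \<comment> \<open>Distinct members of \<open>B\<close> are at distance sqrt 2, whereas a common
    approximant would bring them within distance 1.\<close>
  have "inj_on d B"
  proof (rule inj_onI, rule ccontr)
    fix x y assume xy: "x \<in> B" "y \<in> B" "d x = d y" "x \<noteq> y"
    then have "cinner x (- y) = 0"
      using assms(2) by (simp add: cinner_minus_right)
    from pythagoras[OF this] have "(norm (x - y))\<^sup>2 = 1 + 1"
      using assms(2)[of x x] assms(2)[of y y] xy by (simp add: norm_square_cinner)
    moreover have "dist x y < 1"
      using d(2)[of x] d(2)[of y] dist_triangle_half_r[of "d x" x 1 y] xy(3) by simp
    then have "norm (x - y) < 1"
      by (simp add: dist_norm)
    then have "(norm (x - y))\<^sup>2 < 1"
      by (simp add: power_less_one_iff)
    ultimately show False by simp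
  qed
  then show ?thesis
    using D(1) d(1) by (metis countable_image_inj_on countable_subset image_subset_iff)
qed

lemma maximal_orthonormal_set:
  fixes S :: "'a::complex_hilbert_space set"
  obtains B where "B \<subseteq> oc S"
    "\<And>x y. x \<in> B \<Longrightarrow> y \<in> B \<Longrightarrow> cinner x y = (if x = y then 1 else 0)"
    "\<And>x. x \<in> oc S \<Longrightarrow> x \<in> oc B \<Longrightarrow> x = 0"
proof -
  define ons where "ons B \<longleftrightarrow> B \<subseteq> oc S \<and>
    (\<forall>x\<in>B. \<forall>y\<in>B. cinner x y = (if x = y then 1 else 0))" for B :: "'a set"
  have "\<exists>B\<in>{B. ons B}. \<forall>X\<in>{B. ons B}. B \<subseteq> X \<longrightarrow> X = B"
  proof (rule subset_Zorn')
    fix C assume C: "subset.chain {B. ons B} C"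
    have ons: "ons X" if "X \<in> C" for X
      using that C by (auto simp: subset_chain_def)
    have "cinner x y = (if x = y then 1 else 0)" if xy: "x \<in> \<Union>C" "y \<in> \<Union>C" for x y
    proof -
      from xy obtain X Y where XY: "X \<in> C" "Y \<in> C" "x \<in> X" "y \<in> Y"
        by blast
      with C have "X \<subseteq> Y \<or> Y \<subseteq> X"
        by (auto simp: subset_chain_def)
      with XY obtain Z where "Z \<in> C" "x \<in> Z" "y \<in> Z"
        by blast
      with ons show ?thesis
        by (simp add: ons_def)
    qed
    moreover have "\<Union>C \<subseteq> oc S"
      using ons by (auto simp: ons_def)
    ultimately show "\<Union>C \<in> {B. ons B}"
      unfolding ons_def by blast
  qed
  then obtain B where B: "ons B" "\<And>X. ons X \<Longrightarrow> B \<subseteq> X \<Longrightarrow> X = B"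
    by blast
  have "x = 0" if x: "x \<in> oc S" "x \<in> oc B" for x
  proof (rule ccontr)
    assume "x \<noteq> 0"
    define y where "y = complex_of_real (1 / norm x) *\<^sub>C x"
    have y: "y \<in> oc S" "y \<in> oc B"
      unfolding y_def using x by (intro complex_vector.subspace_scale[OF subspace_oc]; simp)+
    have "norm y = 1"
      using \<open>x \<noteq> 0\<close> norm_scaleC[of "complex_of_real (1 / norm x)" x] by (simp add: y_def norm_divide)
    then have "cinner y y = 1"
      by (simp add: cinner_self)
    then have "ons (insert y B)"
      using B(1) y ocD[OF y(2)] ocD'[OF y(2)] unfolding ons_def by auto
    then have "y \<in> B"
      using B(2) by blast
    then show False
      using oc_self y(2) \<open>cinner y y = 1\<close> by force
  qed
  with B(1) that show ?thesis
    unfolding ons_def by blast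
qed

lemma ex_onb:
  fixes c :: "nat \<Rightarrow> 'a::complex_hilbert_space"
  assumes "separable_space (euclidean :: 'a topology)" "orthonormal c" "range c \<subseteq> oc S"
  obtains e :: "nat \<Rightarrow> 'a" where "onb S e"
proof -
  obtain B where B: "B \<subseteq> oc S"
    "\<And>x y. x \<in> B \<Longrightarrow> y \<in> B \<Longrightarrow> cinner x y = (if x = y then 1 else 0)"
    "\<And>x. x \<in> oc S \<Longrightarrow> x \<in> oc B \<Longrightarrow> x = 0"
    using maximal_orthonormal_set by blast
  have "infinite B"
  proof
    assume "finite B"
    then obtain x where "x \<in> oc S" "norm x = 1" "x \<in> oc B"
      using subspace_pick[OF subspace_oc assms(2,3)] by blast
    with B(3) show False by force
  qed
  with orthonormal_set_countable[OF assms(1) B(2)]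
  have bij: "bij_betw (from_nat_into B) UNIV B"
    by (intro bij_betw_from_nat_into) auto
  then have "range (from_nat_into B) = B" "orthonormal (from_nat_into B)"
    using B(2)[of "from_nat_into B _" "from_nat_into B _"] rangeI[of "from_nat_into B"]
    by (auto simp: orthonormal_def bij_betw_def inj_eq)
  then have "onb S (from_nat_into B)"
    using B(1,3) by (simp add: onb_def)
  with that show ?thesis by blast
qed

lemma ex_onb_UNIV:
  assumes "separable_space (euclidean :: 'a::complex_hilbert_space topology)"
    "infinite_dimensional_hilbert TYPE('a)"
  obtains e :: "nat \<Rightarrow> 'a::complex_hilbert_space" where "onb {} e"
proof -
  obtain B :: "'a set" where B:
    "\<And>x y. x \<in> B \<Longrightarrow> y \<in> B \<Longrightarrow> cinner x y = (if x = y then 1 else 0)"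
    "\<And>x. x \<in> oc B \<Longrightarrow> x = 0"
    using maximal_orthonormal_set[of "{} :: 'a set"] by auto
  have "infinite B"
  proof
    assume fin: "finite B"
    have "x \<in> cspan B" for x
    proof -
      define p where "p = (\<Sum>b\<in>B. cinner x b *\<^sub>C b)"
      have "cinner p b = cinner x b" if "b \<in> B" for b
      proof -
        have "cinner p b = (\<Sum>a\<in>B. if a = b then cinner x b else 0)"
          unfolding p_def cinner_sum_left cinner_scaleC_left
          using B(1) that by (intro sum.cong) auto
        with fin that show ?thesis by simp
      qed
      then have "x - p \<in> oc B"
        by (auto intro!: ocI simp: cinner_diff_left)
      then have "x = p"
        using B(2) by force
      moreover have "p \<in> cspan B"
        unfolding p_def
        by (intro complex_vector.span_sum complex_vector.span_scale complex_vector.span_base)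
      ultimately show ?thesis
        by simp
    qed
    then show False
      using assms(2) fin by (auto simp: infinite_dimensional_hilbert_def)
  qed
  with orthonormal_set_countable[OF assms(1) B(1)]
  have bij: "bij_betw (from_nat_into B) UNIV B"
    by (intro bij_betw_from_nat_into) auto
  then have "range (from_nat_into B) = B" "orthonormal (from_nat_into B)"
    using B(1)[of "from_nat_into B _" "from_nat_into B _"] rangeI[of "from_nat_into B"]
    by (auto simp: orthonormal_def bij_betw_def inj_eq)
  then have "onb {} (from_nat_into B)"
    using B(2) by (simp add: onb_def)
  with that show ?thesis by blast
qed

text \<open>The witnesses \<open>c'\<close> and \<open>d'\<close> say that the complements of \<open>c\<close> and \<open>d\<close> are infinite-dimensional.\<close>

lemma fixator_transitive:
  fixes c d :: "'i::countable \<Rightarrow> 'a::complex_hilbert_space" and c' d' :: "nat \<Rightarrow> 'a"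
  assumes sep: "separable_space (euclidean :: 'a topology)" and inf: "infinite (UNIV :: 'i set)"
    and c: "orthonormal c" "range c \<subseteq> oc S" and c': "orthonormal c'" "range c' \<subseteq> oc (S \<union> range c)"
    and d: "orthonormal d" "range d \<subseteq> oc S" and d': "orthonormal d'" "range d' \<subseteq> oc (S \<union> range d)"
  obtains u where "u \<in> fixator S" "\<And>i. u (c i) = d i"
proof -
  obtain a where a: "onb (S \<union> range c) (a :: nat \<Rightarrow> 'a)"
    using ex_onb[OF sep c'] by blast
  obtain b where b: "onb (S \<union> range d) (b :: nat \<Rightarrow> 'a)"
    using ex_onb[OF sep d'] by blast
  have "infinite (UNIV :: ('i + nat) set)"
    by simp
  from ex_unitary[OF onb_sum[OF a c] onb_sum[OF b d] this]
  obtain u where "u \<in> fixator S" "\<And>i. u (case_sum c a i) = case_sum d b i"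
    by metis
  from this(1) this(2)[of "Inl _"] show ?thesis
    using that by simp
qed

text \<open>If \<open>g\<close> takes \<open>u (x (3 * n))\<close> back to \<open>x (3 * n)\<close>
  and fixes \<open>x (3 * n + 1)\<close>, then \<open>u = uinv g \<circ> (g \<circ> u)\<close> is a
  factorization in which each factor fixes one residue class of the sequence \<open>x\<close>. Such
  a \<open>g\<close> exists when \<open>x n\<close> is orthogonal to \<open>x j\<close> and
  \<open>u (x j)\<close> for all distinct \<open>n\<close> and \<open>j\<close>.\<close>

lemma fixator_factor:
  fixes c :: "nat \<Rightarrow> 'a::complex_hilbert_space"
  assumes sep: "separable_space (euclidean :: 'a topology)"
    and c: "orthonormal c" "range c \<subseteq> oc S" and u: "u \<in> fixator S"
  obtains v w and x y :: "nat \<Rightarrow> 'a" where "v \<in> fixator S" "w \<in> fixator S" "u = v \<circ> w"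
    "orthonormal x" "range x \<subseteq> oc S" "v \<in> fixator (range x)"
    "orthonormal y" "range y \<subseteq> oc S" "w \<in> fixator (range y)"
proof -
  note uu = fixator_unitary[OF u]
  \<comment> \<open>The vector \<open>uinv u h\<close> is included so that \<open>u x\<close> is
    orthogonal to the earlier \<open>h\<close>. Nothing is known about \<open>x n\<close> against
    \<open>u (x n)\<close>, so below they never occur in one system.\<close>
  have "\<exists>x. (x \<in> oc S \<and> norm x = 1) \<and> (\<forall>h\<in>F. x \<in> oc {h, u h, uinv u h})"
    if "finite F" for F
  proof -
    have "finite (\<Union>h\<in>F. {h, u h, uinv u h})"
      using that by simp
    from subspace_pick[OF subspace_oc c this] show ?thesis
      by (auto simp: oc_def)
  qed
  then obtain x :: "nat \<Rightarrow> 'a" where x: "\<And>n. x n \<in> oc S \<and> norm (x n) = 1"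
    and "\<And>j n. j < n \<Longrightarrow> x n \<in> oc {x j, u (x j), uinv u (x j)}"
    using sequence_choice[where Q="\<lambda>x. x \<in> oc S \<and> norm x = 1"
        and R="\<lambda>h x. x \<in> oc {h, u h, uinv u h}"] by blast
  then have less: "cinner (x n) (x j) = 0" "cinner (x n) (u (x j)) = 0"
    "cinner (u (x n)) (x j) = 0" if "j < n" for j n
    using that by (auto simp: oc_def cinner_unitary_inv[OF uu])
  have orth: "cinner (x n) (x j) = 0 \<and> cinner (u (x n)) (x j) = 0 \<and> cinner (x n) (u (x j)) = 0"
    if "j \<noteq> n" for j n
  proof (cases "j < n")
    case True
    then show ?thesis
      using less[OF True] by simp
  next
    case False
    with that have "n < j" by simp
    from less[OF this] show ?thesis
      by (simp add: cinner_eq_0_commute[of "x n" "x j"] cinner_eq_0_commute[of "u (x n)" "x j"]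
          cinner_eq_0_commute[of "x n" "u (x j)"])
  qed
  have unit: "cinner (x n) (x n) = 1" "cinner (u (x n)) (u (x n)) = 1" for n
    using x[of n] by (auto simp: cinner_self unitary_operator_norm[OF uu])
  have xo: "orthonormal x"
    using orth unit by (auto simp: orthonormal_def)
  have inj: "inj (\<lambda>n::nat. 3 * n)" "inj (\<lambda>n::nat. 3 * n + 1)" "inj (\<lambda>n::nat. 3 * n + 2)"
    by (auto intro: injI)
  have ne: "3 * m \<noteq> Suc (3 * n)" "3 * m \<noteq> Suc (Suc (3 * n))" "Suc (3 * m) \<noteq> Suc (Suc (3 * n))"
    "Suc (3 * n) \<noteq> 3 * m" "Suc (Suc (3 * n)) \<noteq> 3 * m" "Suc (Suc (3 * n)) \<noteq> Suc (3 * m)" for m n :: nat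
    by presburger+
  define a where "a = case_sum (\<lambda>n. u (x (3 * n))) (\<lambda>n. x (3 * n + 1))"
  define b where "b = case_sum (\<lambda>n. x (3 * n)) (\<lambda>n. x (3 * n + 1))"
  have ux: "u (x n) \<in> oc S" for n
    using x u by (simp add: fixator_oc)
  have a: "orthonormal a" "range a \<subseteq> oc S"
    using x ux unfolding a_def
    by (auto simp: orthonormal_def unit orth ne cinner_unitary[OF uu] orthonormalD[OF xo]
        split: sum.splits)
  have b: "orthonormal b" "range b \<subseteq> oc S"
    using x unfolding b_def
    by (auto simp: orthonormal_def unit orth ne split: sum.splits)
  \<comment> \<open>The third residue class is orthogonal to both \<open>a\<close> and
    \<open>b\<close> and supplies the room in their complements that
    \<open>fixator_transitive\<close> requires.\<close>
  have o2: "orthonormal (\<lambda>n. x (3 * n + 2))"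
    using xo inj(3) by (rule orthonormal_comp)
  have "x (3 * n + 2) \<in> oc (range a)" "x (3 * n + 2) \<in> oc (range b)" for n
    unfolding a_def b_def by (auto intro!: ocI simp: orth ne split: sum.splits)
  with x have "range (\<lambda>n. x (3 * n + 2)) \<subseteq> oc (S \<union> range a)"
    "range (\<lambda>n. x (3 * n + 2)) \<subseteq> oc (S \<union> range b)"
    by (auto simp: oc_Un)
  note 2 = fixator_transitive[OF sep _ a o2 this(1) b o2 this(2)]
  have "infinite (UNIV :: (nat + nat) set)"
    by simp
  with 2 obtain g where g: "g \<in> fixator S" "\<And>i. g (a i) = b i"
    by metis
  note gu = fixator_unitary[OF g(1)]
  have g0: "g (u (x (3 * n))) = x (3 * n)" and g1: "g (x (3 * n + 1)) = x (3 * n + 1)" for n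
    using g(2)[of "Inl n"] g(2)[of "Inr n"] by (simp_all add: a_def b_def)
  show ?thesis
  proof
    show "uinv g \<in> fixator S" "g \<circ> u \<in> fixator S"
      using g(1) u by (simp_all add: fixator_inv fixator_comp)
    show "u = uinv g \<circ> (g \<circ> u)"
      by (auto simp: unitary_inv[OF gu])
    show "orthonormal (\<lambda>n. x (3 * n + 1))" "orthonormal (\<lambda>n. x (3 * n))"
      using orthonormal_comp[OF xo inj(2)] orthonormal_comp[OF xo inj(1)] by simp_all
    show "range (\<lambda>n. x (3 * n + 1)) \<subseteq> oc S" "range (\<lambda>n. x (3 * n)) \<subseteq> oc S"
      using x by auto
    have "g \<in> fixator (range (\<lambda>n. x (3 * n + 1)))"
      using gu g1 by (auto intro: fixatorI)
    then show "uinv g \<in> fixator (range (\<lambda>n. x (3 * n + 1)))"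
      by (rule fixator_inv)
    show "g \<circ> u \<in> fixator (range (\<lambda>n. x (3 * n)))"
      using gu uu g0 by (auto intro!: fixatorI unitary_operator_comp)
  qed
qed

text \<open>The images of the blocks under the \<open>u k\<close> form a new basis, and
  \<open>v\<close> is the change of basis; thus no infinite product of operators has to
  converge.\<close>

lemma ex_direct_sum:
  fixes e :: "'k::countable \<times> 'j::countable \<Rightarrow> 'a::complex_hilbert_space"
  assumes e: "onb S e" and inf: "infinite (UNIV :: 'j set)"
    and u: "\<And>k. u k \<in> fixator (S \<union> {e (l, j) |l j. l \<noteq> k})"
  obtains v where "v \<in> fixator S" "\<And>k j. v (e (k, j)) = u k (e (k, j))"
proof -
  note o = onb_orthonormal[OF e]
  have uu: "unitary_operator (u k)" for k
    using u fixator_unitary by blast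
  have uS: "u k \<in> fixator S" for k
    using u fixator_antimono[of S "S \<union> {e (l, j) |l j. l \<noteq> k}"] by blast
  have off: "u k (e (l, j)) = e (l, j)" if "l \<noteq> k" for k l j
    using u that by (intro fixatorD[OF u]) auto
  have block: "onb (S \<union> {e (l, j) |l j. l \<noteq> k}) (\<lambda>j. e (k, j))" for k
    using e by (rule onb_restrict) (auto intro: injI)
  have off': "u l (u k (e (k, j))) = u k (e (k, j))" if "l \<noteq> k" for k l j
  proof -
    have "u l \<in> fixator (range (\<lambda>j. e (k, j)))"
      using that off uu by (intro fixatorI) auto
    from fixator_commute[OF block inf u this] show ?thesis
      using off that by metis
  qed
  define f where "f = (\<lambda>(k, j). u k (e (k, j)))"
  have "onb S f"
    unfolding onb_def
  proof (intro conjI ballI impI)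
    have "cinner (u k (e (k, j))) (u l (e (l, i))) = (if (k, j) = (l, i) then 1 else 0)" for k j l i
    proof (cases "k = l")
      case True
      then show ?thesis
        by (simp add: cinner_unitary[OF uu] orthonormalD[OF o])
    next
      case False
      then have "cinner (u k (e (k, j))) (u l (e (l, i))) = cinner (u k (e (k, j))) (e (l, i))"
        by (metis cinner_unitary[OF uu] off')
      also have "\<dots> = cinner (u k (e (k, j))) (u k (e (l, i)))"
        using False off by simp
      finally show ?thesis
        using False by (simp add: cinner_unitary[OF uu] orthonormalD[OF o])
    qed
    then show "orthonormal f"
      by (auto simp: f_def orthonormal_def)
    show "range f \<subseteq> oc S"
      using fixator_oc[OF uS] onb_in_oc[OF e] by (auto simp: f_def)
    fix x assume x: "x \<in> oc S" "x \<in> oc (range f)"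
    \<comment> \<open>As \<open>x\<close> is orthogonal to the image of block \<open>k\<close>, its
      preimage under \<open>u k\<close> is orthogonal to block \<open>k\<close>, hence among the
      vectors fixed by \<open>u k\<close>. So \<open>x\<close> equals this preimage.\<close>
    have "cinner x (e (k, j)) = 0" for k j
    proof -
      have "cinner (uinv (u k) x) (e (k, j)) = 0" for j
        using ocD[OF x(2) rangeI[of f "(k, j)"]] cinner_unitary_inv[OF unitary_inv(1)[OF uu]]
        by (simp add: f_def unitary_inv_inv[OF uu])
      then have "uinv (u k) x \<in> oc (range (\<lambda>j. e (k, j)))"
        by (auto intro: ocI)
      then have "uinv (u k) x \<in> oc (oc (S \<union> {e (l, j) |l j. l \<noteq> k}))"
        using oc_range_onb[OF block inf] by simp
      then have "u k (uinv (u k) x) = uinv (u k) x"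
        using fixator_oc_oc[OF u] fixatorD by blast
      then have "x = uinv (u k) x"
        using unitary_inv[OF uu] by simp
      then show ?thesis
        using \<open>cinner (uinv (u k) x) (e (k, j)) = 0\<close> by simp
    qed
    then show "x = 0"
      using x(1) by (intro onb_eq_0[OF e]) (auto intro: ocI)
  qed
  moreover have "infinite (UNIV :: ('k \<times> 'j) set)"
    using inf by (simp add: finite_prod)
  ultimately obtain v where "v \<in> fixator S" "\<And>i. v (e i) = f i"
    using ex_unitary[OF e] by metis
  with that show ?thesis
    by (simp add: f_def)
qed

section \<open>Finite-rank perturbations of the identity\<close>

lemma compact_operator_rank_one:
  "compact_operator (\<lambda>x. cinner x a *\<^sub>C b :: 'a::complex_hilbert_space)"
  unfolding compact_operator_def
proof
  have lin: "bounded_linear (\<lambda>c. c *\<^sub>C b)"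
    by (rule bounded_linear_intro[where K="norm b"])
       (auto simp: scaleC_add_left scaleR_scaleC scaleC_scaleC norm_scaleC scaleR_conv_of_real)
  show "bounded_operator (\<lambda>x. cinner x a *\<^sub>C b)"
    using bounded_linear_compose[OF lin bounded_linear_cinner_left]
    by (simp add: bounded_operator_def cinner_scaleC_left scaleC_scaleC)
  have "compact ((\<lambda>c. c *\<^sub>C b) ` cball 0 (norm a))"
    by (intro compact_continuous_image linear_continuous_on lin compact_cball)
  moreover have "(\<lambda>x. cinner x a *\<^sub>C b) ` cball 0 1 \<subseteq> (\<lambda>c. c *\<^sub>C b) ` cball 0 (norm a)"
  proof
    fix y assume "y \<in> (\<lambda>x. cinner x a *\<^sub>C b) ` cball 0 1"
    then obtain x where x: "norm x \<le> 1" "y = cinner x a *\<^sub>C b"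
      by auto
    have "cmod (cinner x a) \<le> norm x * norm a"
      by (rule Cauchy_Schwarz_cinner)
    also have "\<dots> \<le> norm a"
      using x(1) by (simp add: mult_left_le_one_le)
    finally show "y \<in> (\<lambda>c. c *\<^sub>C b) ` cball 0 (norm a)"
      using x(2) by auto
  qed
  ultimately show "compact (closure ((\<lambda>x. cinner x a *\<^sub>C b) ` cball 0 1))"
    using compact_closure_subset by blast
qed

lemma compact_operator_sum:
  "finite F \<Longrightarrow> (\<And>i. i \<in> F \<Longrightarrow> compact_operator (f i)) \<Longrightarrow> compact_operator (\<lambda>x. \<Sum>i\<in>F. f i x)"
proof (induction F rule: finite_induct)
  case (insert i F)
  then have "compact_operator (\<lambda>x. f i x + (\<Sum>j\<in>F. f j x))"
    by (intro compact_operator_add) auto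
  with insert.hyps show ?case
    by simp
qed (simp add: compact_operator_zero)

text \<open>Since \<open>u\<close> fixes the closed span of the unmoved basis vectors,
  \<open>u - 1\<close> factors through the projection \<open>p\<close> onto the finitely many moved
  ones and has finite rank.\<close>

lemma compact_unitaries_finite:
  assumes e: "onb {} e" and u: "unitary_operator u" and fin: "finite {i. u (e i) \<noteq> e i}"
  shows "u \<in> compact_unitaries"
proof -
  let ?F = "{i. u (e i) \<noteq> e i}"
  define p where "p x = (\<Sum>i\<in>?F. cinner x (e i) *\<^sub>C e i)" for x
  note o = onb_orthonormal[OF e]
  have "u x - x = (\<Sum>i\<in>?F. cinner x (e i) *\<^sub>C (u (e i) - e i))" for x
  proof -
    have p: "cinner (y - p y) (e i) = (if i \<in> ?F then 0 else cinner y (e i))" for y i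
      by (simp add: p_def cinner_diff_left cinner_orthonormal_sum[OF o fin])
    have "u \<in> fixator (e ` (- ?F))"
      using u by (auto intro: fixatorI)
    then have "u \<in> fixator (oc (oc (e ` (- ?F))))"
      by (rule fixator_oc_oc)
    moreover have "x - p x \<in> oc (oc (e ` (- ?F)))"
    proof (rule ocI)
      fix y assume y: "y \<in> oc (e ` (- ?F))"
      have "cinner (y - p y) (e i) = 0" for i
        using p[of y i] ocD[OF y, of "e i"] by (cases "i \<in> ?F") simp_all
      then have "y - p y \<in> oc (range e)"
        by (auto intro: ocI)
      then have "y - p y = 0"
        by (intro onb_eq_0[OF e]) simp_all
      then have "p y = y"
        by (rule iffD2[OF eq_iff_diff_eq_0, THEN sym])
      then have "cinner (x - p x) y = cinner (x - p x) (p y)"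
        by (simp only:)
      also have "\<dots> = (\<Sum>i\<in>?F. cnj (cinner y (e i)) * cinner (x - p x) (e i))"
        by (simp only: p_def[of y] cinner_sum_right cinner_scaleC_right)
      also have "\<dots> = 0"
      proof (intro sum.neutral ballI)
        fix i assume "i \<in> ?F"
        then have "cinner (x - p x) (e i) = 0"
          unfolding p by (rule if_P)
        then show "cnj (cinner y (e i)) * cinner (x - p x) (e i) = 0"
          by (rule mult_eq_0_iff[THEN iffD2, OF disjI2])
      qed
      finally show "cinner (x - p x) y = 0" .
    qed
    ultimately have "u (x - p x) = x - p x"
      by (rule fixatorD)
    then have "u x - u (p x) = x - p x"
      by (simp only: unitary_additive(2)[OF u])
    then have "u x - x = u (p x) - p x"
      by (simp add: algebra_simps)
    also have "u (p x) = (\<Sum>i\<in>?F. cinner x (e i) *\<^sub>C u (e i))"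
    proof -
      have "u (\<Sum>i\<in>G. cinner x (e i) *\<^sub>C e i) = (\<Sum>i\<in>G. cinner x (e i) *\<^sub>C u (e i))" if "finite G" for G
        using that by (induction G) (simp_all add: unitary_additive[OF u])
      then show ?thesis
        using fin by (simp add: p_def)
    qed
    finally show ?thesis
      by (simp add: p_def complex_vector.scale_right_diff_distrib sum_subtractf)
  qed
  then have "(\<lambda>x. u x - x) = (\<lambda>x. \<Sum>i\<in>?F. cinner x (e i) *\<^sub>C (u (e i) - e i))"
    by (rule ext)
  moreover have "compact_operator (\<lambda>x. \<Sum>i\<in>?F. cinner x (e i) *\<^sub>C (u (e i) - e i))"
    using fin by (intro compact_operator_sum compact_operator_rank_one)
  ultimately have "compact_operator (\<lambda>x. u x - x)"
    by (simp only:)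
  then show ?thesis
    using u by (simp add: compact_unitaries_def unitary_group_def)
qed

section \<open>Countably syndetic sets of unitaries\<close>

primrec compositions :: "('a \<Rightarrow> 'a) set \<Rightarrow> nat \<Rightarrow> ('a \<Rightarrow> 'a) set" where
  "compositions W 0 = {id}"
| "compositions W (Suc n) = {w \<circ> u |w u. w \<in> W \<and> u \<in> compositions W n}"

lemma compositions_comp:
  "u \<in> compositions W m \<Longrightarrow> v \<in> compositions W n \<Longrightarrow> u \<circ> v \<in> compositions W (m + n)"
proof (induction m arbitrary: u)
  case (Suc m)
  then obtain w u' where u: "u = w \<circ> u'" "w \<in> W" "u' \<in> compositions W m"
    by auto
  have "u \<circ> v = w \<circ> (u' \<circ> v)"
    unfolding u(1) by (rule comp_assoc)
  moreover have "u' \<circ> v \<in> compositions W (m + n)"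
    using u(3) Suc.prems(2) by (rule Suc.IH)
  ultimately show ?case
    using u(2) unfolding add_Suc compositions.simps by blast
qed simp

lemma compositions_1: "u \<in> W \<Longrightarrow> u \<in> compositions W 1"
  by (auto intro: exI[of _ id])

section \<open>Bilateral shifts of infinite multiplicity\<close>

definition shift_on :: "'a::complex_hilbert_space set \<Rightarrow> ('a \<Rightarrow> 'a) \<Rightarrow> (int \<times> nat \<Rightarrow> 'a) \<Rightarrow> bool" where
  "shift_on S v q \<longleftrightarrow> orthonormal q \<and> range q \<subseteq> oc S \<and> v \<in> fixator (oc (range q)) \<and>
     (\<forall>z j. v (q (z, j)) = q (z + 1, j)) \<and>
     (\<exists>c :: nat \<Rightarrow> 'a. orthonormal c \<and> range c \<subseteq> oc (S \<union> range q))"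

lemma shift_onD:
  assumes "shift_on S v q"
  shows "orthonormal q" "range q \<subseteq> oc S" "v \<in> fixator (oc (range q))"
    "v (q (z, j)) = q (z + 1, j)"
    "\<exists>c :: nat \<Rightarrow> 'a::complex_hilbert_space. orthonormal c \<and> range c \<subseteq> oc (S \<union> range q)"
  using assms by (simp_all only: shift_on_def)

lemma infinite_int_nat [simp]: "infinite (UNIV :: (int \<times> nat) set)"
  by (simp add: finite_prod infinite_UNIV_int)

lemma oc_range_total: "oc (range q \<union> oc (range q)) \<subseteq> {0}"
  using oc_self_closure by (auto simp: oc_Un)

lemma onb_oc_range: "orthonormal q \<Longrightarrow> onb (oc (range q)) q"
  unfolding onb_def using subset_oc_oc[of "range q"] oc_self_closure[of _ "range q"] by auto

text \<open>The infinite-dimensional remainder required by \<open>shift_on\<close> allows some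
  \<open>g\<close> in \<open>fixator S\<close> to carry one indexed system onto the other. It
  intertwines the shifts on the systems and takes the fixed part of one to the fixed part of the
  other.\<close>

lemma shift_on_conj:
  assumes sep: "separable_space (euclidean :: 'a::complex_hilbert_space topology)"
    and v: "shift_on S v q" and v': "shift_on S v' (q' :: int \<times> nat \<Rightarrow> 'a)"
  obtains g where "g \<in> fixator S" "v' = g \<circ> v \<circ> uinv g"
proof -
  note q = shift_onD(1,2)[OF v] shift_onD(1,2)[OF v'] and vf = shift_onD(3)[OF v] shift_onD(3)[OF v']
    and vq = shift_onD(4)[OF v] shift_onD(4)[OF v']
  obtain c c' :: "nat \<Rightarrow> 'a" where c: "orthonormal c" "range c \<subseteq> oc (S \<union> range q)"
    "orthonormal c'" "range c' \<subseteq> oc (S \<union> range q')"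
    using shift_onD(5)[OF v] shift_onD(5)[OF v'] by (elim exE conjE)
  obtain g where g: "g \<in> fixator S" "\<And>i. g (q i) = q' i"
    using fixator_transitive[OF sep infinite_int_nat q(1,2) c(1,2) q(3,4) c(3,4)] by blast
  note gu = fixator_unitary[OF g(1)]
  have gq: "uinv g (q' i) = q i" for i
    by (metis g(2) unitary_inv(2)[OF gu])
  have "v' = g \<circ> v \<circ> uinv g"
  proof (rule unitary_eqI[OF _ _ _ oc_range_total[of q']])
    show "unitary_operator v'" "unitary_operator (g \<circ> v \<circ> uinv g)"
      using vf gu unitary_inv(1)[OF gu] by (auto dest: fixator_unitary intro!: unitary_operator_comp)
    fix x assume "x \<in> range q' \<union> oc (range q')"
    then consider z j where "x = q' (z, j)" | "x \<in> oc (range q')"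
      by auto
    then show "v' x = (g \<circ> v \<circ> uinv g) x"
    proof cases
      case 1
      then show ?thesis by (simp add: vq gq g(2))
    next
      case 2
      then have "uinv g x \<in> oc (range q)"
        by (auto intro!: ocI simp: cinner_unitary_inv[OF unitary_inv(1)[OF gu]]
            unitary_inv_inv[OF gu] g(2) dest: ocD)
      with 2 show ?thesis
        by (simp add: fixatorD[OF vf(1)] fixatorD[OF vf(2)] unitary_inv[OF gu])
    qed
  qed
  with g(1) that show ?thesis by blast
qed

text \<open>
  The infinite swindle: if \<open>D\<close> is the direct sum of copies of \<open>u\<close> over the nonnegative positions
  of the bilateral shift \<open>v\<close>, then \<open>D\<close> and its shifted copy differ by a single \<open>u\<close>.
\<close>

lemma shift_commutator:
  fixes x :: "nat \<Rightarrow> 'a::complex_hilbert_space"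
  assumes sep: "separable_space (euclidean :: 'a topology)"
    and x: "orthonormal x" "range x \<subseteq> oc S"
    and uS: "u \<in> fixator S" and ux: "u \<in> fixator (range x)"
  obtains v q D where "shift_on S v q" "D \<in> fixator S" "u = (D \<circ> v \<circ> uinv D) \<circ> uinv v"
proof -
  note uu = fixator_unitary[OF uS]
  \<comment> \<open>The even terms are taken out of the space on which \<open>u\<close> acts; the
    odd terms ensure that what is left, with basis \<open>k\<close>, is
    infinite-dimensional.\<close>
  define R where "R = range (\<lambda>n. x (2 * n))"
  have xodd: "orthonormal (\<lambda>n. x (2 * n + 1))"
    using x(1) by (rule orthonormal_comp) (auto intro: injI)
  have parity: "2 * m \<noteq> Suc (2 * n)" "Suc (2 * n) \<noteq> 2 * m" for m n :: nat
    by presburger+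
  have xS: "x n \<in> oc S" for n
    using x(2) by auto
  have "x (2 * n + 1) \<in> oc R" for n
    by (auto simp: R_def parity orthonormalD[OF x(1)] intro!: ocI)
  with xS have "range (\<lambda>n. x (2 * n + 1)) \<subseteq> oc (S \<union> R)"
    by (auto simp: oc_Un)
  then obtain k :: "nat \<Rightarrow> 'a" where k: "onb (S \<union> R) k"
    using ex_onb[OF sep xodd] by blast
  have kS: "k j \<in> oc S" "k j \<in> oc R" for j
    using onb_in_oc[OF k] by (auto simp: oc_Un)
  have kx: "cinner (k j) (x (2 * n)) = 0" "cinner (x (2 * n)) (k j) = 0" for j n
    using ocD[OF kS(2), of "x (2 * n)"] ocD'[OF kS(2), of "x (2 * n)"] by (auto simp: R_def)
  \<comment> \<open>Position 0 is the whole space on which \<open>u\<close> can act; the other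
    positions are filled with even terms of \<open>x\<close>. The terms with index
    \<open>to_nat (0, j)\<close> are left over and witness the remainder \<open>c\<close>.\<close>
  define q :: "int \<times> nat \<Rightarrow> 'a" where
    "q = (\<lambda>(z, j). if z = 0 then k j else x (2 * to_nat (z, j)))"
  have q0: "q (0, j) = k j" for j
    by (simp add: q_def)
  have qo: "orthonormal q"
    using onb_orthonormal[OF k] x(1) kx
    by (auto simp: orthonormal_def q_def)
  have qS: "range q \<subseteq> oc S"
    using kS xS by (auto simp: q_def)
  note qonb = onb_oc_range[OF qo]
  have Sq: "S \<subseteq> oc (range q)"
    using qS subset_oc_oc oc_antimono by blast
  have qfix: "fixator (oc (range q)) \<subseteq> fixator S"
    using Sq by (rule fixator_antimono)
  define c where "c = (\<lambda>j. x (2 * to_nat (0 :: int, j :: nat)))"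
  have "orthonormal c"
    unfolding c_def using x(1) by (rule orthonormal_comp) (auto intro!: injI)
  moreover have "c j \<in> oc (range q)" for j
    using kx by (auto simp: c_def q_def orthonormalD[OF x(1)] intro!: ocI)
  then have "range c \<subseteq> oc (S \<union> range q)"
    using xS by (auto simp: oc_Un c_def)
  ultimately have room: "\<exists>c :: nat \<Rightarrow> 'a. orthonormal c \<and> range c \<subseteq> oc (S \<union> range q)"
    by blast
  have "\<exists>t\<in>fixator (oc (range q)). \<forall>w j. t (q (w, j)) = q (w + z, j)" for z
  proof -
    have "bij (\<lambda>(w, j). (w + z, j :: nat))"
      by (rule bij_betw_byWitness[where f'="\<lambda>(w, j). (w - z, j)"]) auto
    from ex_unitary[OF qonb onb_reindex[OF qonb this] infinite_int_nat]
    obtain t where "t \<in> fixator (oc (range q))" "\<And>i. t (q i) = q (case i of (w, j) \<Rightarrow> (w + z, j))"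
      by blast
    then show ?thesis by (intro bexI[of _ t]) auto
  qed
  then obtain t where t: "\<And>z. t z \<in> fixator (oc (range q))"
    "\<And>z w j. t z (q (w, j)) = q (w + z, j)"
    by metis
  note tu = fixator_unitary[OF t(1)]
  have tinv: "uinv (t z) (q (w, j)) = q (w - z, j)" for z w j
    using unitary_inv(2)[OF tu, of z "q (w - z, j)"] by (simp add: t(2))
  have tadd: "t 1 (t z y) = t (z + 1) y" for z y
  proof -
    have "t 1 \<circ> t z = t (z + 1)"
    proof (rule unitary_eqI[OF _ _ _ oc_range_total[of q]])
      show "unitary_operator (t 1 \<circ> t z)" "unitary_operator (t (z + 1))"
        using tu by (auto intro: unitary_operator_comp)
      fix y assume "y \<in> range q \<union> oc (range q)"
      then show "(t 1 \<circ> t z) y = t (z + 1) y"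
        using fixatorD[OF t(1)] by (auto simp: t(2) algebra_simps)
    qed
    from fun_cong[OF this, of y] show ?thesis by simp
  qed
  have uR: "u \<in> fixator (S \<union> R)"
    using uS ux by (auto simp: fixator_Un R_def fixator_def)
  have uk: "u \<in> fixator (oc (range k))"
    using fixator_oc_oc[OF uR] oc_range_onb[OF k] by simp
  have "range k \<subseteq> range q"
    by (auto simp flip: q0)
  then have "oc (range q) \<subseteq> oc (range k)"
    by (rule oc_antimono)
  then have uq: "u \<in> fixator (oc (range q))"
    using uk fixator_antimono by blast
  have qk: "q (z, j) \<in> oc (range k)" if "z \<noteq> 0" for z j
    using that by (auto intro!: ocI simp: orthonormalD[OF qo] simp flip: q0)
  have fixq: "u (q (z, j)) = q (z, j)" if "z \<noteq> 0" for z j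
    using qk[OF that] by (rule fixatorD[OF uk])
  define U where "U z = (if z \<ge> 0 then t z \<circ> u \<circ> uinv (t z) else id)" for z
  have U: "U z \<in> fixator (oc (range q) \<union> {q (l, j) |l j. l \<noteq> z})" for z
  proof (cases "z \<ge> 0")
    case True
    have "t z \<circ> u \<circ> uinv (t z) \<in> fixator (oc (range q))"
      using uq t(1) by (intro fixator_comp fixator_inv)
    then show ?thesis
      using True fixq by (auto simp: U_def fixator_def tinv t(2))
  qed (simp add: U_def)
  obtain D where D: "D \<in> fixator (oc (range q))" "\<And>z j. D (q (z, j)) = U z (q (z, j))"
    using ex_direct_sum[OF qonb infinite_UNIV_nat U] by blast
  note Du = fixator_unitary[OF D(1)]
  have Dneg: "D (q (z, j)) = q (z, j)" if "z < 0" for z j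
    using that by (simp add: D(2) U_def)
  have Dpos: "D (q (z, j)) = t z (u (q (0, j)))" if "z \<ge> 0" for z j
    using that by (simp add: D(2) U_def tinv)
  \<comment> \<open>The copy of \<open>u\<close> at a position \<open>z > 0\<close> stays orthogonal
    to position 0, where the single extra \<open>u\<close> is supported.\<close>
  have far: "u (t z (u (q (0, j)))) = t z (u (q (0, j)))" if "z > 0" for z j
  proof -
    have "t z (u (q (0, j))) \<in> oc (range k)"
    proof (rule ocI)
      fix s assume "s \<in> range k"
      then obtain i where s: "s = q (0, i)"
        using q0 by auto
      have "cinner (t z (u (q (0, j)))) s = cinner (q (0, j)) (uinv u (q (0 - z, i)))"
        by (simp add: s cinner_unitary_inv[OF tu] cinner_unitary_inv[OF uu] tinv)
      also have "uinv u (q (0 - z, i)) = q (0 - z, i)"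
        using that fixq[of "0 - z" i] unitary_inv(2)[OF uu, of "q (0 - z, i)"] by simp
      also have "cinner (q (0, j)) (q (0 - z, i)) = 0"
        using that by (simp add: orthonormalD[OF qo])
      finally show "cinner (t z (u (q (0, j)))) s = 0" .
    qed
    then show ?thesis
      by (rule fixatorD[OF uk])
  qed
  have main: "u \<circ> t 1 \<circ> D = D \<circ> t 1"
  proof (rule unitary_eqI[OF _ _ _ oc_range_total[of q]])
    show "unitary_operator (u \<circ> t 1 \<circ> D)" "unitary_operator (D \<circ> t 1)"
      using tu Du uu by (auto intro!: unitary_operator_comp)
    fix y assume "y \<in> range q \<union> oc (range q)"
    then consider z j where "y = q (z, j)" | "y \<in> oc (range q)"
      by auto
    then show "(u \<circ> t 1 \<circ> D) y = (D \<circ> t 1) y"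
    proof cases
      case 1
      \<comment> \<open>The boundary is \<open>z = - 1\<close>: there \<open>D\<close> is trivial,
        and after the shift the extra \<open>u\<close> on the left does what the first copy inside
        \<open>D\<close> does on the right.\<close>
      consider "z < - 1" | "z = - 1" | "z \<ge> 0" by linarith
      then show ?thesis
      proof cases
        case 1
        then show ?thesis
          using \<open>y = q (z, j)\<close> by (simp add: Dneg t(2) fixq)
      next
        case 2
        have "t 0 (u (q (0, j))) = u (q (0, j))"
        proof -
          have "t 1 (t 0 (u (q (0, j)))) = t 1 (u (q (0, j)))"
            by (simp add: tadd)
          then show ?thesis
            using unitary_inj[OF tu] by (meson injD)
        qed
        with 2 show ?thesis
          using \<open>y = q (z, j)\<close> by (simp add: Dneg t(2) Dpos)
      next
        case 3
        then show ?thesis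
          using \<open>y = q (z, j)\<close> by (simp add: Dpos t(2) tadd far)
      qed
    next
      case 2
      then show ?thesis
        using fixatorD[OF uq] fixatorD[OF t(1)] fixatorD[OF D(1)] by simp
    qed
  qed
  have "u = (D \<circ> t 1 \<circ> uinv D) \<circ> uinv (t 1)"
  proof
    fix y
    have "(D \<circ> t 1 \<circ> uinv D \<circ> uinv (t 1)) y = (u \<circ> t 1 \<circ> D) (uinv D (uinv (t 1) y))"
      unfolding main by simp
    also have "\<dots> = u y"
      by (simp add: unitary_inv[OF Du] unitary_inv[OF tu])
    finally show "u y = (D \<circ> t 1 \<circ> uinv D \<circ> uinv (t 1)) y" ..
  qed
  moreover have "shift_on S (t 1) q"
    unfolding shift_on_def using qo qS t room by simp
  moreover have "D \<in> fixator S"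
    using D(1) qfix by blast
  ultimately show ?thesis
    using that by blast
qed

lemma unitary_inv_comp:
  assumes "unitary_operator u" "unitary_operator v"
  shows "uinv (u \<circ> v) = uinv v \<circ> uinv u"
proof (rule ext)
  fix x
  have "uinv (u \<circ> v) ((u \<circ> v) (uinv v (uinv u x))) = uinv v (uinv u x)"
    using assms by (intro unitary_inv(2) unitary_operator_comp)
  then show "uinv (u \<circ> v) x = (uinv v \<circ> uinv u) x"
    by (simp add: unitary_inv(3)[OF assms(1)] unitary_inv(3)[OF assms(2)])
qed

section \<open>Pigeonhole and diagonal arguments against a countable cover\<close>

lemma nat_set_pigeonhole:
  fixes c :: "nat set \<Rightarrow> nat"
  obtains a b where "a \<noteq> b" "c a = c b"
proof -
  have "\<not> inj c"
  proof
    assume "inj c"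
    then have "range (inv_into UNIV c) = UNIV"
      by (rule inj_imp_surj_inv)
    then show False
      using Cantors_theorem[of "UNIV :: nat set"] by auto
  qed
  then show ?thesis
    using that by (auto simp: inj_def)
qed

lemma ex_projection:
  fixes a :: "nat \<Rightarrow> 'a::complex_hilbert_space"
  assumes "onb S a"
  obtains s where "s \<in> oc S" "x - s \<in> oc (oc S)"
proof
  note o = onb_orthonormal[OF assms]
  show "transport a a x \<in> oc S"
    using o assms by (rule transport_in_oc)
  have "x - transport a a x \<in> oc (range a)"
    by (auto intro!: ocI simp: cinner_diff_left cinner_transport_basis[OF o o])
  then show "x - transport a a x \<in> oc (oc S)"
    using oc_range_onb[OF assms infinite_UNIV_nat] by simp
qed

lemma ex_permutation_unitary:
  fixes e :: "'i::countable \<Rightarrow> 'a::complex_hilbert_space"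
  assumes "onb S e" "infinite (UNIV :: 'i set)" "bij p"
  obtains g where "g \<in> fixator S" "\<And>i. g (e i) = e (p i)"
  using ex_unitary[OF assms(1) onb_reindex[OF assms(1,3)] assms(2)] that by metis

lemma infinite_index [simp]: "infinite (UNIV :: (nat \<times> nat \<times> int) set)"
  by (simp add: finite_prod infinite_UNIV_int)

text \<open>The target group survives only in this form: \<open>C n\<close> stands for the preimage
  of a translate of a neighbourhood and \<open>W\<close> for that of its set of quotients. Neither
  is assumed closed under composition, hence the bookkeeping of factors.\<close>

locale syndetic =
  fixes W :: "('a::complex_hilbert_space \<Rightarrow> 'a) set" and C :: "nat \<Rightarrow> ('a \<Rightarrow> 'a) set"
  assumes separable: "separable_space (euclidean :: 'a topology)"
    and infinite_dim: "infinite_dimensional_hilbert TYPE('a)"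
    and unitary_W: "u \<in> W \<Longrightarrow> unitary_operator u"
    and inv_W: "u \<in> W \<Longrightarrow> uinv u \<in> W"
    and compact_W: "compact_unitaries \<subseteq> W"
    and unitary_C: "u \<in> C n \<Longrightarrow> unitary_operator u"
    and cover_C: "unitary_operator u \<Longrightarrow> \<exists>n. u \<in> C n"
    and quotient_C: "u \<in> C n \<Longrightarrow> v \<in> C n \<Longrightarrow> uinv u \<circ> v \<in> W"
begin

lemma unitary_compositions: "u \<in> compositions W n \<Longrightarrow> unitary_operator u"
  by (induction n arbitrary: u) (auto simp: unitary_operator_id unitary_W intro: unitary_operator_comp)

lemma inv_compositions: "u \<in> compositions W n \<Longrightarrow> uinv u \<in> compositions W n"
proof (induction n arbitrary: u)
  case 0
  then show ?case by (auto simp: inv_id fun_eq_iff)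
next
  case (Suc n)
  then obtain w u' where u: "u = w \<circ> u'" "w \<in> W" "u' \<in> compositions W n"
    by auto
  have "uinv u = uinv u' \<circ> uinv w"
    unfolding u(1) using u by (intro unitary_inv_comp unitary_W unitary_compositions)
  moreover have "uinv u' \<circ> uinv w \<in> compositions W (n + 1)"
    using u by (intro compositions_comp Suc.IH compositions_1 inv_W)
  ultimately show ?case
    by (simp only: Suc_eq_plus1)
qed

lemma conj_compositions:
  "g \<in> compositions W m \<Longrightarrow> u \<in> compositions W n \<Longrightarrow> g \<circ> u \<circ> uinv g \<in> compositions W (m + n + m)"
  by (intro compositions_comp inv_compositions)

lemma pigeonhole_family:
  fixes g :: "nat set \<Rightarrow> 'a \<Rightarrow> 'a"
  assumes "\<And>a. unitary_operator (g a)"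
  obtains a b where "a \<noteq> b" "uinv (g a) \<circ> g b \<in> W"
proof -
  obtain c where c: "\<And>a. g a \<in> C (c a)"
    using choice[of "\<lambda>a n. g a \<in> C n"] cover_C[OF assms] by blast
  obtain a b where "a \<noteq> b" "c a = c b"
    using nat_set_pigeonhole by blast
  with c[of a] c[of b] that quotient_C show ?thesis
    by metis
qed

text \<open>If every block \<open>k\<close> had a unitary that no member of \<open>C k\<close>
  copies on that block, the direct sum of these unitaries would lie in no \<open>C n\<close>. The
  result gives agreement on the block only; outside it the element of \<open>W\<close> is
  uncontrolled.\<close>

lemma ex_full_block:
  fixes e :: "nat \<times> 'j::countable \<Rightarrow> 'a"
  assumes e: "onb {} e" and inf: "infinite (UNIV :: 'j set)"
  obtains k where "\<And>u. u \<in> fixator {e (l, j) |l j. l \<noteq> k} \<Longrightarrow> \<exists>w\<in>W. \<forall>j. w (e (k, j)) = u (e (k, j))"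
proof -
  define S where "S k = {e (l, j) |l j. l \<noteq> k}" for k
  have "\<exists>k. \<forall>u\<in>fixator (S k). \<exists>c\<in>C k. \<forall>j. c (e (k, j)) = u (e (k, j))"
  proof (rule ccontr)
    assume "\<not> ?thesis"
    then obtain u where u: "\<And>k. u k \<in> fixator (S k)"
      "\<And>k c. c \<in> C k \<Longrightarrow> \<exists>j. c (e (k, j)) \<noteq> u k (e (k, j))"
      by metis
    have "u k \<in> fixator ({} \<union> {e (l, j) |l j. l \<noteq> k})" for k
      using u(1) by (simp add: S_def)
    from ex_direct_sum[OF e inf this] obtain v where
      "v \<in> fixator {}" and v: "\<And>k j. v (e (k, j)) = u k (e (k, j))"
      by blast
    then obtain n where "v \<in> C n"
      using cover_C[of v] by auto
    with u(2)[OF this] v show False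
      by blast
  qed
  then obtain k where k: "\<And>u. u \<in> fixator (S k) \<Longrightarrow> \<exists>c\<in>C k. \<forall>j. c (e (k, j)) = u (e (k, j))"
    by blast
  have block: "onb (S k) (\<lambda>j. e (k, j))"
    using e by (rule onb_restrict) (auto simp: S_def intro: injI)
  have full: "\<exists>w\<in>W. \<forall>j. w (e (k, j)) = u (e (k, j))" if u: "u \<in> fixator (S k)" for u
  proof -
    obtain c where c: "c \<in> C k" "\<And>j. c (e (k, j)) = u (e (k, j))"
      using k[OF u] by blast
    \<comment> \<open>Dividing by a member of the same \<open>C k\<close> that is the identity on
      the block leads from \<open>C k\<close> into \<open>W\<close> without changing the action on
      the block.\<close>
    obtain c1 where c1: "c1 \<in> C k" "\<And>j. c1 (e (k, j)) = e (k, j)"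
      using k[OF fixator_id] by auto
    have "c1 \<in> fixator (range (\<lambda>j. e (k, j)))"
      using c1 unitary_C by (auto intro!: fixatorI)
    then have c1': "uinv c1 \<in> fixator (range (\<lambda>j. e (k, j)))"
      by (rule fixator_inv)
    have "(uinv c1 \<circ> c) (e (k, j)) = u (e (k, j))" for j
      using fixator_commute[OF block inf u c1', of "e (k, j)"] fixatorD[OF c1', of "e (k, j)"] c(2)
      by simp
    with quotient_C[OF c1(1) c(1)] show ?thesis
      by blast
  qed
  show ?thesis
    using full unfolding S_def by (rule that)
qed

text \<open>A \<open>w\<close> in \<open>W\<close> that agrees with \<open>u\<close> on
  \<open>oc S\<close> differs from it by a factor acting trivially there, which commutes with
  \<open>v\<close>. So conjugating \<open>v\<close> by an arbitrary \<open>u\<close> in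
  \<open>fixator S\<close> is the same as conjugating by \<open>w\<close>, and the uncontrolled part
  of \<open>w\<close> cancels.\<close>

lemma full_block_conj:
  fixes b :: "'j::countable \<Rightarrow> 'a"
  assumes b: "onb S b" "infinite (UNIV :: 'j set)"
    and full: "\<And>u. u \<in> fixator S \<Longrightarrow> \<exists>w\<in>W. \<forall>j. w (b j) = u (b j)"
    and u: "u \<in> fixator S" and v: "v \<in> fixator S" "v \<in> W"
  shows "u \<circ> v \<circ> uinv u \<in> compositions W 3"
proof -
  obtain w where w: "w \<in> W" "\<And>j. w (b j) = u (b j)"
    using full[OF u] by blast
  note uu = fixator_unitary[OF u] and wu = unitary_W[OF w(1)]
  have "uinv u \<circ> w \<in> fixator (range b)"
    using uu wu unitary_inv(1)[OF uu]
    by (intro fixatorI unitary_operator_comp) (auto simp: w(2) unitary_inv[OF uu])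
  then have comm: "v (uinv u (w x)) = uinv u (w (v x))" for x
    using fixator_commute[OF b v(1), of "uinv u \<circ> w" x] by simp
  have "u \<circ> v \<circ> uinv u = w \<circ> v \<circ> uinv w"
  proof
    fix x
    show "(u \<circ> v \<circ> uinv u) x = (w \<circ> v \<circ> uinv w) x"
      using comm[of "uinv w x"] by (simp add: unitary_inv[OF uu] unitary_inv[OF wu])
  qed
  moreover have "w \<circ> v \<circ> uinv w \<in> compositions W (1 + 1 + 1)"
    using w v by (intro conj_compositions compositions_1)
  moreover have "(1 + 1 + 1 :: nat) = 3"
    by simp
  ultimately show ?thesis
    by (simp only:)
qed

text \<open>
  Coordinatewise powers, with exponents \<open>0\<close> and \<open>1\<close>, of a bilateral shift form an uncountable
  family in which any two members differ by a bilateral shift of infinite multiplicity.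
\<close>

lemma ex_shift_in_W:
  fixes e :: "nat \<times> nat \<times> nat \<times> int \<Rightarrow> 'a"
  assumes e: "onb {} e"
  obtains v q where "v \<in> W" "v \<in> fixator {e (l, j) |l j. l \<noteq> k}" "shift_on {e (l, j) |l j. l \<noteq> k} v q"
proof -
  note o = onb_orthonormal[OF e]
  define S where "S = {e (l, j) |l j. l \<noteq> k}"
  \<comment> \<open>The coordinates are block, row, copy and position. The successor keeps row 0
    unmoved for every \<open>a\<close>, which leaves an infinite-dimensional fixed part; the copies
    \<open>m\<close> give infinite multiplicity even if \<open>a\<close> and \<open>b\<close> differ
    in a single row.\<close>
  define p where "p = (\<lambda>(a :: nat set) (l :: nat, n :: nat, m :: nat, z :: int).
    (l, n, m, if l = k \<and> n \<in> Suc ` a then z + 1 else z))"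
  have "bij (p a)" for a
    by (rule bij_betw_byWitness[where f'="\<lambda>(l, n, m, z).
      (l, n, m, if l = k \<and> n \<in> Suc ` a then z - 1 else z)"]) (auto simp: p_def)
  moreover have "infinite (UNIV :: (nat \<times> nat \<times> nat \<times> int) set)"
    by (simp add: finite_prod infinite_UNIV_int)
  ultimately have "\<exists>g. unitary_operator g \<and> (\<forall>i. g (e i) = e (p a i))" for a
    using ex_permutation_unitary[OF e, of "p a"] by (metis fixator_unitary)
  then obtain g where g: "\<And>a. unitary_operator (g a)" "\<And>a i. g a (e i) = e (p a i)"
    by metis
  obtain a b where ab: "a \<noteq> b" "uinv (g a) \<circ> g b \<in> W"
    by (rule pigeonhole_family[of g, OF g(1)])
  define v where "v = uinv (g a) \<circ> g b"
  have vu: "unitary_operator v"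
    using ab(2) unitary_W by (simp add: v_def)
  define d :: "nat \<Rightarrow> int" where
    "d n = (if n \<in> Suc ` b then 1 else 0) - (if n \<in> Suc ` a then 1 else 0)" for n
  have v: "v (e (l, n, m, z)) = e (l, n, m, if l = k then z + d n else z)" for l n m z
  proof -
    have "g a (e (l, n, m, if l = k then z + d n else z)) = g b (e (l, n, m, z))"
      by (simp add: g(2) p_def d_def)
    then have "uinv (g a) (g b (e (l, n, m, z))) = e (l, n, m, if l = k then z + d n else z)"
      using unitary_inv(2)[OF g(1)] by metis
    then show ?thesis
      by (simp add: v_def)
  qed
  define D where "D = {n. d n \<noteq> 0}"
  have d: "d n * d n = 1" if "n \<in> D" for n
    using that by (auto simp: D_def d_def split: if_splits)
  obtain i where "(i \<in> a) \<noteq> (i \<in> b)"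
    using ab(1) by blast
  then have "Suc i \<in> D"
    by (auto simp: D_def d_def)
  have "infinite (D \<times> (UNIV :: nat set))"
    using \<open>Suc i \<in> D\<close> by (auto simp: finite_cartesian_product_iff)
  then have *: "bij_betw (from_nat_into (D \<times> UNIV)) UNIV (D \<times> (UNIV :: nat set))"
    by (intro bij_betw_from_nat_into) auto
  define r s where "r j = fst (from_nat_into (D \<times> (UNIV :: nat set)) j)"
    and "s j = snd (from_nat_into (D \<times> (UNIV :: nat set)) j)" for j
  have rs: "bij_betw (\<lambda>j. (r j, s j)) UNIV (D \<times> UNIV)"
    using * by (simp add: r_def s_def)
  have rD: "r j \<in> D" for j
    using rs by (auto simp: bij_betw_def)
  \<comment> \<open>Rows along which the quotient steps by -1 are read backwards, so that
    \<open>v\<close> raises every position by one.\<close>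
  define f where "f = (\<lambda>(z, j). (k, r j, s j, d (r j) * z))"
  have "inj f"
  proof (intro injI, clarify)
    fix z z' j j' assume "f (z, j) = f (z', j')"
    then have "(r j, s j) = (r j', s j') \<and> d (r j) * z = d (r j') * z'"
      unfolding f_def prod.case prod.inject by blast
    moreover from this have "j = j'"
      using injD[OF bij_betw_imp_inj_on[OF rs], of j j'] by blast
    moreover have "d (r j) \<noteq> 0"
      using rD[of j] by (simp add: D_def)
    ultimately show "z = z' \<and> j = j'"
      by simp
  qed
  define q where "q = (\<lambda>i. e (f i))"
  have q: "onb ({} \<union> e ` (- range f)) q"
    unfolding q_def using e \<open>inj f\<close> by (rule onb_restrict) simp
  have range_f: "(k, n, m, z) \<in> range f" if "n \<in> D" for n m z
  proof -
    have "(n, m) \<in> range (\<lambda>j. (r j, s j))"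
      using that bij_betw_imp_surj_on[OF rs] by simp
    then obtain j where "r j = n" "s j = m"
      by auto
    then have "f (d n * z, j) = (k, n, m, z)"
      using d[OF that] by (simp add: f_def flip: mult.assoc)
    then show ?thesis
      by (metis rangeI)
  qed
  have "v (e i) = e i" if "i \<notin> range f" for i
  proof -
    obtain l n m z where i: "i = (l, n, m, z)"
      by (cases i) auto
    then have "l \<noteq> k \<or> d n = 0"
      using that range_f by (auto simp: D_def)
    then show ?thesis
      by (auto simp: i v)
  qed
  then have vfix: "v \<in> fixator ({} \<union> e ` (- range f))"
    using vu by (auto intro!: fixatorI)
  have "S \<subseteq> e ` (- range f)"
    by (auto simp: S_def f_def)
  then have vS: "v \<in> fixator S"
    using vfix fixator_antimono[of S "e ` (- range f)"] by auto
  have "shift_on S v q"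
    unfolding shift_on_def
  proof (intro conjI allI)
    show "orthonormal q"
      using q by (rule onb_orthonormal)
    show "range q \<subseteq> oc S"
      by (auto simp: q_def f_def S_def orthonormalD[OF o] intro!: ocI)
    show "v \<in> fixator (oc (range q))"
      using fixator_oc_oc[OF vfix] oc_range_onb[OF q infinite_int_nat] by simp
    show "v (q (z, j)) = q (z + 1, j)" for z j
      by (simp add: q_def f_def v algebra_simps)
    have "orthonormal (\<lambda>m. e (k, 0, m, 0))"
      using o by (rule orthonormal_comp) (auto intro: injI)
    moreover have "r j \<noteq> 0" for j
      using rD[of j] by (intro notI) (simp add: D_def d_def image_iff)
    then have "e (k, 0, m, 0) \<in> oc (S \<union> range q)" for m
      by (auto simp: S_def q_def f_def orthonormalD[OF o] intro!: ocI)
    ultimately show "\<exists>c :: nat \<Rightarrow> 'a. orthonormal c \<and> range c \<subseteq> oc (S \<union> range q)"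
      by blast
  qed
  with ab(2) vS that show ?thesis
    by (simp add: v_def S_def)
qed

text \<open>All shifts on \<open>S\<close> are conjugate to the one \<open>v\<close> in
  \<open>W\<close>, so each costs 3. The swindle writes a unitary with an infinite-dimensional fixed
  space inside \<open>oc S\<close> as a quotient of two shifts, and \<open>fixator_factor\<close>
  reduces the general case to two of these.\<close>

lemma fixator_compositions_12:
  fixes b :: "'j::countable \<Rightarrow> 'a"
  assumes b: "onb S b" "infinite (UNIV :: 'j set)"
    and full: "\<And>u. u \<in> fixator S \<Longrightarrow> \<exists>w\<in>W. \<forall>j. w (b j) = u (b j)"
    and v: "v \<in> W" "v \<in> fixator S" "shift_on S v q"
  shows "fixator S \<subseteq> compositions W 12"
proof
  fix u assume u: "u \<in> fixator S"
  have six: "w \<in> compositions W 6" if w: "w \<in> fixator S" "w \<in> fixator (range x)"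
    and x: "orthonormal x" "range x \<subseteq> oc S" for w and x :: "nat \<Rightarrow> 'a"
  proof -
    obtain t p D where t: "shift_on S t p" "D \<in> fixator S" "w = (D \<circ> t \<circ> uinv D) \<circ> uinv t"
      using shift_commutator[OF separable x w] by blast
    obtain g where g: "g \<in> fixator S" "t = g \<circ> v \<circ> uinv g"
      using shift_on_conj[OF separable v(3) t(1)] by blast
    have conj: "g \<circ> v \<circ> uinv g \<in> compositions W 3" if "g \<in> fixator S" for g
      by (rule full_block_conj[OF b full that v(2,1)])
    have t3: "t \<in> compositions W 3"
      unfolding g(2) using g(1) by (rule conj)
    have "uinv (D \<circ> g) = uinv g \<circ> uinv D"
      using t(2) g(1) by (intro unitary_inv_comp fixator_unitary)
    then have "D \<circ> t \<circ> uinv D = (D \<circ> g) \<circ> v \<circ> uinv (D \<circ> g)"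
      unfolding g(2) by (simp only: comp_assoc)
    moreover have "(D \<circ> g) \<circ> v \<circ> uinv (D \<circ> g) \<in> compositions W 3"
      using t(2) g(1) by (intro conj fixator_comp)
    ultimately have "D \<circ> t \<circ> uinv D \<in> compositions W 3"
      by (simp only:)
    then have "w \<in> compositions W (3 + 3)"
      unfolding t(3) using inv_compositions[OF t3] by (rule compositions_comp)
    then show ?thesis by simp
  qed
  obtain c :: "nat \<Rightarrow> 'a" where c: "orthonormal c" "range c \<subseteq> oc (S \<union> range q)"
    using shift_onD(5)[OF v(3)] by blast
  then have cS: "range c \<subseteq> oc S"
    by (auto simp: oc_Un)
  obtain w w' and x y :: "nat \<Rightarrow> 'a" where
    ww: "w \<in> fixator S" "w' \<in> fixator S" "u = w \<circ> w'"
    and x: "orthonormal x" "range x \<subseteq> oc S" "w \<in> fixator (range x)"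
    and y: "orthonormal y" "range y \<subseteq> oc S" "w' \<in> fixator (range y)"
    by (rule fixator_factor[OF separable c(1) cS u])
  have "u \<in> compositions W (6 + 6)"
    unfolding ww(3) using six[OF ww(1) x(3,1,2)] six[OF ww(2) y(3,1,2)] by (rule compositions_comp)
  then show "u \<in> compositions W 12"
    by simp
qed

text \<open>The block singled out by the diagonal argument becomes \<open>oc (range z)\<close>,
  where \<open>z\<close> lists the basis vectors of all other blocks.\<close>

lemma ex_half:
  obtains z a :: "nat \<Rightarrow> 'a" where "orthonormal z" "onb (range z) a"
    "fixator (range z) \<subseteq> compositions W 12"
proof -
  obtain e0 :: "nat \<Rightarrow> 'a" where e0: "onb {} e0"
    using ex_onb_UNIV[OF separable infinite_dim] by blast
  have inf4: "infinite (UNIV :: (nat \<times> nat \<times> nat \<times> int) set)"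
    by (simp add: finite_prod infinite_UNIV_int)
  then obtain h :: "nat \<Rightarrow> nat \<times> nat \<times> nat \<times> int" where h: "bij h"
    using ex_enum by blast
  define e where "e = (\<lambda>i. e0 (inv_into UNIV h i))"
  have e: "onb {} e"
    unfolding e_def using e0 bij_imp_bij_inv[OF h] by (rule onb_reindex)
  obtain k where full: "\<And>u. u \<in> fixator {e (l, j) |l j. l \<noteq> k} \<Longrightarrow>
      \<exists>w\<in>W. \<forall>j. w (e (k, j)) = u (e (k, j))"
    using ex_full_block[OF e infinite_index] by blast
  define S where "S = {e (l, j) |l j. l \<noteq> k}"
  have block: "onb S (\<lambda>j. e (k, j))"
    using e by (rule onb_restrict) (auto simp: S_def intro: injI)
  obtain v q where v: "v \<in> W" "v \<in> fixator S" "shift_on S v q"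
    using ex_shift_in_W[OF e, of k] unfolding S_def by blast
  have 12: "fixator S \<subseteq> compositions W 12"
    by (rule fixator_compositions_12[OF block infinite_index full[folded S_def] v])
  define I where "I = {(l, j). l \<noteq> k} \<inter> (UNIV :: (nat \<times> nat \<times> nat \<times> int) set)"
  have "inj (\<lambda>n. (k + 1 + n, 0, 0, 0) :: nat \<times> nat \<times> nat \<times> int)"
    by (auto intro: injI)
  moreover have "range (\<lambda>n. (k + 1 + n, 0, 0, 0)) \<subseteq> I"
    by (auto simp: I_def)
  ultimately have "infinite I"
    using infinite_iff_countable_subset by blast
  then have bij: "bij_betw (from_nat_into I) UNIV I"
    by (intro bij_betw_from_nat_into) auto
  define z where "z = (\<lambda>n. e (from_nat_into I n))"
  have "orthonormal z"
    unfolding z_def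
    by (rule orthonormal_comp[OF onb_orthonormal[OF e]]) (use bij in \<open>simp add: bij_betw_def\<close>)
  moreover have "range (from_nat_into I) = I"
    using bij by (simp add: bij_betw_def)
  then have "range z = e ` I"
    unfolding z_def by (metis image_image)
  then have "range z = S"
    unfolding S_def by (auto simp: I_def)
  moreover obtain f :: "nat \<Rightarrow> nat \<times> nat \<times> int" where "bij f"
    using ex_enum[OF infinite_index] by blast
  ultimately show ?thesis
    using onb_reindex[OF block, of f] 12 by (intro that[of z "\<lambda>j. e (k, f j)"]) simp_all
qed

end

section \<open>Two halves and the transport of fixed subspaces\<close>

context syndetic
begin

text \<open>
  The involution \<open>p A\<close> exchanges the half \<open>z\<close> with the branch of \<open>A\<close> in the binary tree; distinct
  branches share only finitely many nodes, and these are cleared by a finite permutation, which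
  lies in \<open>compact_unitaries\<close>.
\<close>

lemma ex_disjoint_halves:
  obtains x y z :: "nat \<Rightarrow> 'a" where "orthonormal x" "orthonormal z" "onb (range x \<union> range z) y"
    "range x \<subseteq> oc (range z)"
    "fixator (range z) \<subseteq> compositions W 12" "fixator (range x) \<subseteq> compositions W 16"
proof -
  obtain z a0 :: "nat \<Rightarrow> 'a" where z: "orthonormal z" "onb (range z) a0"
    and 12: "fixator (range z) \<subseteq> compositions W 12"
    using ex_half by blast
  have "infinite (UNIV :: (bool list + nat) set)"
    by simp
  then obtain f :: "nat \<Rightarrow> bool list + nat" where f: "bij f"
    using ex_enum by blast
  \<comment> \<open>The basis of the complement of \<open>z\<close> is divided into nodes of the
    binary tree, indexed by \<open>bool list\<close>, and a reserve indexed by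
    \<open>nat\<close>.\<close>
  define a where "a = (\<lambda>i. a0 (inv_into UNIV f i))"
  have a: "onb ({} \<union> range z) a"
    unfolding a_def using onb_reindex[OF z(2) bij_imp_bij_inv[OF f]] by simp
  define E where "E = case_sum z a"
  have E: "onb {} E"
    unfolding E_def using a z(1) by (rule onb_sum) simp
  note o = onb_orthonormal[OF E]
  have infE: "infinite (UNIV :: (nat + bool list + nat) set)"
    by simp
  have zE: "z n = E (Inl n)" for n
    by (simp add: E_def)
  define br where "br A n = map (\<lambda>i. i \<in> A) [0..<n]" for A :: "nat set" and n
  have length_br [simp]: "length (br A n) = n" for A n
    by (simp add: br_def)
  define p :: "nat set \<Rightarrow> nat + bool list + nat \<Rightarrow> nat + bool list + nat" where
    "p A = case_sum (\<lambda>n. Inr (Inl (br A n)))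
      (case_sum (\<lambda>w. if w = br A (length w) then Inl (length w) else Inr (Inl w)) (\<lambda>m. Inr (Inr m)))" for A
  have p_invol: "p A (p A i) = i" for A i
    by (auto simp: p_def split: sum.splits)
  then have "bij (p A)" for A
    by (rule involuntory_imp_bij)
  then have "\<exists>g. unitary_operator g \<and> (\<forall>i. g (E i) = E (p A i))" for A
    using ex_permutation_unitary[OF E infE, of "p A"] by (metis fixator_unitary)
  then obtain g where g: "\<And>A. unitary_operator (g A)" "\<And>A i. g A (E i) = E (p A i)"
    by metis
  obtain A B where AB: "A \<noteq> B" "uinv (g A) \<circ> g B \<in> W"
    by (rule pigeonhole_family[of g, OF g(1)])
  have ginv: "uinv (g A) (E i) = E (p A i)" for i
    using unitary_inv(2)[OF g(1), of A "E (p A i)"] by (simp add: g(2) p_invol)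
  obtain k where k: "(k \<in> A) \<noteq> (k \<in> B)"
    using AB(1) by blast
  have br_neq: "br B n \<noteq> br A n" if "n > k" for n
  proof
    assume "br B n = br A n"
    then have "br B n ! k = br A n ! k"
      by simp
    with k that show False
      by (simp add: br_def)
  qed
  \<comment> \<open>Beyond depth \<open>k\<close> the branches of \<open>A\<close> and
    \<open>B\<close> have separated. The remaining \<open>z n\<close> with \<open>n \<le> k\<close>
    are exchanged with reserve vectors, which every \<open>p A\<close> leaves alone.\<close>
  define t :: "nat + bool list + nat \<Rightarrow> nat + bool list + nat" where
    "t = case_sum (\<lambda>n. if n \<le> k then Inr (Inr n) else Inl n)
      (case_sum (\<lambda>w. Inr (Inl w)) (\<lambda>n. if n \<le> k then Inl n else Inr (Inr n)))"
  have "t (t i) = i" for i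
    by (auto simp: t_def split: sum.splits)
  then have "bij t"
    by (rule involuntory_imp_bij)
  then obtain T where T: "T \<in> fixator {}" "\<And>i. T (E i) = E (t i)"
    using ex_permutation_unitary[OF E infE] by blast
  have t_id: "t i = i" if "i \<notin> Inl ` {..k} \<union> (\<lambda>n. Inr (Inr n)) ` {..k}" for i
  proof -
    consider n where "i = Inl n" | w where "i = Inr (Inl w)" | n where "i = Inr (Inr n)"
      by (metis sum.exhaust)
    then show ?thesis
      using that by cases (auto simp: t_def)
  qed
  have "{i. T (E i) \<noteq> E i} \<subseteq> Inl ` {..k} \<union> (\<lambda>n. Inr (Inr n)) ` {..k}"
  proof (rule subsetI, rule ccontr)
    fix i assume "i \<in> {i. T (E i) \<noteq> E i}" and i: "i \<notin> Inl ` {..k} \<union> (\<lambda>n. Inr (Inr n)) ` {..k}"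
    then have "E (t i) \<noteq> E i"
      by (simp add: T(2))
    with t_id[OF i] show False
      by simp
  qed
  then have "finite {i. T (E i) \<noteq> E i}"
    by (rule finite_subset) simp
  then have "T \<in> compact_unitaries"
    using T(1) by (intro compact_unitaries_finite[OF E]) simp_all
  then have TW: "T \<in> W"
    using compact_W by blast
  define h where "h = (uinv (g A) \<circ> g B) \<circ> T"
  have "h \<in> compositions W (1 + 1)"
    unfolding h_def using compositions_1[OF AB(2)] compositions_1[OF TW] by (rule compositions_comp)
  then have h2: "h \<in> compositions W 2"
    by (simp only: one_add_one)
  then have hu: "unitary_operator h"
    by (rule unitary_compositions)
  define x where "x = (\<lambda>n. h (z n))"
  \<comment> \<open>For \<open>n > k\<close>, \<open>g B\<close> sends \<open>z n\<close> to a node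
    off the branch of \<open>A\<close>, and \<open>uinv (g A)\<close> leaves that node in place.
    Hence no \<open>x n\<close> is one of the \<open>z\<close>.\<close>
  have xE: "x n = E (Inr (if n \<le> k then Inr n else Inl (br B n)))" for n
    using br_neq[of n] by (auto simp: x_def h_def zE T(2) t_def g(2) ginv p_def)
  have xo: "orthonormal x"
    unfolding x_def using hu z(1) by (rule orthonormal_unitary)
  have xz: "range x \<subseteq> oc (range z)"
    by (auto simp: xE zE orthonormalD[OF o] intro!: ocI)
  have "orthonormal (\<lambda>j. E (Inr (Inr (k + 1 + j))))"
    using o by (rule orthonormal_comp) (auto intro: injI)
  moreover have "range (\<lambda>j. E (Inr (Inr (k + 1 + j)))) \<subseteq> oc (range x \<union> range z)"
    by (auto simp: xE zE orthonormalD[OF o] intro!: ocI)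
  ultimately obtain y :: "nat \<Rightarrow> 'a" where y: "onb (range x \<union> range z) y"
    using ex_onb[OF separable] by blast
  have "fixator (range x) \<subseteq> compositions W 16"
  proof
    fix v assume v: "v \<in> fixator (range x)"
    note vu = fixator_unitary[OF v]
    have "uinv h \<circ> v \<circ> h \<in> fixator (range z)"
    proof (rule fixatorI)
      show "unitary_operator (uinv h \<circ> v \<circ> h)"
        using hu vu unitary_inv(1)[OF hu] by (intro unitary_operator_comp)
      fix s assume "s \<in> range z"
      then have "h s \<in> range x"
        by (auto simp: x_def)
      then show "(uinv h \<circ> v \<circ> h) s = s"
        using fixatorD[OF v] unitary_inv(2)[OF hu] by simp
    qed
    then have "uinv h \<circ> v \<circ> h \<in> compositions W 12"
      using 12 by blast
    with h2 have "h \<circ> (uinv h \<circ> v \<circ> h) \<circ> uinv h \<in> compositions W (2 + 12 + 2)"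
      by (rule conj_compositions)
    moreover have "h \<circ> (uinv h \<circ> v \<circ> h) \<circ> uinv h = v"
      by (simp add: fun_eq_iff unitary_inv[OF hu])
    ultimately show "v \<in> compositions W 16"
      by simp
  qed
  with that[OF xo z(1) y xz 12] show ?thesis
    by blast
qed

text \<open>A sequence of vectors fixed by \<open>u\<close> is moved onto \<open>z\<close>, which
  puts a conjugate of \<open>u\<close> into \<open>fixator (range z)\<close>. Elements of that group
  cannot alter components along \<open>z\<close>, but \<open>g1\<close> can push the other
  components into the span of \<open>y\<close>, away from \<open>x\<close>. The vectors are then
  orthogonal to \<open>x\<close>, so some \<open>g2\<close> in \<open>fixator (range x)\<close>
  finishes the move.\<close>

lemma fixing_sequence_compositions:
  fixes l :: "nat \<Rightarrow> 'a"
  assumes l: "orthonormal l" and u: "u \<in> fixator (range l)"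
  shows "u \<in> compositions W 68"
proof -
  obtain x y z :: "nat \<Rightarrow> 'a" where x: "orthonormal x" and z: "orthonormal z"
    and y: "onb (range x \<union> range z) y" and xz: "range x \<subseteq> oc (range z)"
    and fz: "fixator (range z) \<subseteq> compositions W 12" and fx: "fixator (range x) \<subseteq> compositions W 16"
    by (rule ex_disjoint_halves)
  note uu = fixator_unitary[OF u] and yo = onb_orthonormal[OF y]
  obtain a :: "nat \<Rightarrow> 'a" where a: "onb (range z) a"
    using ex_onb[OF separable x xz] by blast
  have yz: "y n \<in> oc (range z)" and yx: "y n \<in> oc (range x)" for n
    using onb_in_oc[OF y] by (auto simp: oc_Un)
  define M where "M = {v. u v = v}"
  have M: "complex_vector.subspace M"
    by (simp add: complex_vector.subspace_def M_def unitary_additive[OF uu])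
  have lM: "range l \<subseteq> M"
    using fixatorD[OF u] by (auto simp: M_def)
  \<comment> \<open>The unit vector \<open>c\<close> carries the component of \<open>e\<close> in
    \<open>oc (range z)\<close>, namely a multiple \<open>t\<close> of it, possibly zero.\<close>
  define Q where "Q = (\<lambda>(e, c). e \<in> M \<and> norm e = 1 \<and> c \<in> oc (range z) \<and> norm c = 1 \<and>
    (\<exists>t. e - t *\<^sub>C c \<in> oc (oc (range z))))"
  \<comment> \<open>A new \<open>e'\<close> is also made orthogonal to the old \<open>c\<close>: as
    \<open>c\<close> lies in \<open>oc (range z)\<close>, the component of \<open>e'\<close> in that
    space is then orthogonal to \<open>c\<close>, so the new \<open>c'\<close> can be chosen
    orthogonal too.\<close>
  define R where "R = (\<lambda>(e :: 'a, c :: 'a) (e' :: 'a, c' :: 'a). cinner e' e = 0 \<and> cinner e' c = 0 \<and> cinner c' c = 0)"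
  have step: "\<exists>q. Q q \<and> (\<forall>h\<in>F. R h q)" if F: "finite F" "\<forall>h\<in>F. Q h" for F :: "('a \<times> 'a) set"
  proof -
    have "finite (fst ` F \<union> snd ` F)"
      using F(1) by simp
    then obtain e where e: "e \<in> M" "norm e = 1" "e \<in> oc (fst ` F \<union> snd ` F)"
      using subspace_pick[OF M l lM] by blast
    obtain s where s: "s \<in> oc (range z)" "e - s \<in> oc (oc (range z))"
      using ex_projection[OF a] by blast
    have Fz: "c \<in> oc (range z)" if "(b, c) \<in> F" for b c
      using F(2) that by (auto simp: Q_def)
    have "\<exists>c t. c \<in> oc (range z) \<and> norm c = 1 \<and> c \<in> oc (snd ` F) \<and> e - t *\<^sub>C c \<in> oc (oc (range z))"
    proof (cases "s = 0")
      case True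
      \<comment> \<open>With no component in \<open>oc (range z)\<close>, any suitable unit vector
        serves, with coefficient 0.\<close>
      obtain c where "c \<in> oc (range z)" "norm c = 1" "c \<in> oc (snd ` F)"
        using subspace_pick[OF subspace_oc x xz] F(1) by (metis finite_imageI)
      with s(2) True show ?thesis
        by (intro exI[of _ c] exI[of _ 0]) simp
    next
      case False
      define c where "c = complex_of_real (1 / norm s) *\<^sub>C s"
      have "norm c = 1"
        using False norm_scaleC[of "complex_of_real (1 / norm s)" s] by (simp add: c_def norm_divide)
      moreover have "c \<in> oc (range z)"
        unfolding c_def using s(1) by (rule complex_vector.subspace_scale[OF subspace_oc])
      moreover have "s \<in> oc (snd ` F)"
      proof (rule ocI)
        fix d assume d: "d \<in> snd ` F"
        then have "d \<in> oc (range z)"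
          using Fz by force
        then have "cinner (e - s) d = 0"
          using s(2) ocD by blast
        moreover have "cinner e d = 0"
          using e(3) d ocD by blast
        ultimately show "cinner s d = 0"
          by (simp add: cinner_diff_left)
      qed
      then have "c \<in> oc (snd ` F)"
        unfolding c_def by (rule complex_vector.subspace_scale[OF subspace_oc])
      moreover have "complex_of_real (norm s) *\<^sub>C c = s"
        using False by (simp add: c_def scaleC_scaleC scaleC_one)
      ultimately show ?thesis
        using s(2) by metis
    qed
    then obtain c t where c: "c \<in> oc (range z)" "norm c = 1" "c \<in> oc (snd ` F)"
      "e - t *\<^sub>C c \<in> oc (oc (range z))"
      by blast
    have "Q (e, c)"
      using e c by (auto simp: Q_def)
    moreover have "R (b, d) (e, c)" if "(b, d) \<in> F" for b d
      using that ocD[OF e(3), of b] ocD[OF e(3), of d] ocD[OF c(3), of d] by (force simp: R_def)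
    ultimately show ?thesis
      by (intro exI[of _ "(e, c)"]) auto
  qed
  obtain q :: "nat \<Rightarrow> 'a \<times> 'a" where q: "\<And>n. Q (q n)" "\<And>j n. j < n \<Longrightarrow> R (q j) (q n)"
    using sequence_choice[of Q R, OF step] by blast
  define e0 c0 where "e0 n = fst (q n)" and "c0 n = snd (q n)" for n :: nat
  have eM: "e0 n \<in> M" and e1: "norm (e0 n) = 1" and cz: "c0 n \<in> oc (range z)" and c1: "norm (c0 n) = 1"
    and "\<exists>t. e0 n - t *\<^sub>C c0 n \<in> oc (oc (range z))" for n
    using q(1)[of n] by (auto simp: Q_def e0_def c0_def case_prod_beta)
  then obtain t where t: "\<And>n. e0 n - t n *\<^sub>C c0 n \<in> oc (oc (range z))"
    by metis
  have less: "cinner (e0 n) (e0 j) = 0" "cinner (c0 n) (c0 j) = 0" if "j < n" for j n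
    using q(2)[OF that] by (auto simp: R_def e0_def c0_def case_prod_beta)
  have "cinner (e0 i) (e0 j) = 0" "cinner (c0 i) (c0 j) = 0" if "i \<noteq> j" for i j
    using less[of i j] less[of j i] that
      cinner_eq_0_commute[of "e0 i" "e0 j"] cinner_eq_0_commute[of "c0 i" "c0 j"]
    by (cases i j rule: linorder_cases; simp)+
  then have e0: "orthonormal e0" and c0: "orthonormal c0"
    using e1 c1 by (auto simp: orthonormal_def cinner_self)
  have inj2: "inj (\<lambda>n::nat. 2 * n)" "inj (\<lambda>n::nat. 2 * n + 1)"
    by (auto intro: injI)
  have parity: "2 * m \<noteq> Suc (2 * n)" "Suc (2 * n) \<noteq> 2 * m" for m n :: nat
    by presburger+
  \<comment> \<open>Every second term is dropped so that the chosen \<open>c\<close> have an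
    infinite-dimensional complement within \<open>oc (range z)\<close>; the same is done with the
    targets in \<open>y\<close>.\<close>
  define e c where "e n = e0 (2 * n)" and "c n = c0 (2 * n)" for n
  obtain g1 where g1: "g1 \<in> fixator (range z)" "\<And>n. g1 (c n) = y (2 * n)"
  proof (rule fixator_transitive[OF separable infinite_UNIV_nat, of c "range z" "\<lambda>n. c0 (2 * n + 1)"
        "\<lambda>n. y (2 * n)" "\<lambda>n. y (2 * n + 1)"])
    show "orthonormal c"
      unfolding c_def using c0 inj2(1) by (rule orthonormal_comp)
    show "orthonormal (\<lambda>n. c0 (2 * n + 1))"
      using c0 inj2(2) by (rule orthonormal_comp)
    show "orthonormal (\<lambda>n. y (2 * n))"
      using yo inj2(1) by (rule orthonormal_comp)
    show "orthonormal (\<lambda>n. y (2 * n + 1))"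
      using yo inj2(2) by (rule orthonormal_comp)
    show "range c \<subseteq> oc (range z)" "range (\<lambda>n. y (2 * n)) \<subseteq> oc (range z)"
      using cz yz by (auto simp: c_def)
    have "c0 (2 * n + 1) \<in> oc (range c)" "y (2 * n + 1) \<in> oc (range (\<lambda>n. y (2 * n)))" for n
      unfolding c_def using c0 yo by (auto intro!: ocI simp: orthonormal_def parity)
    with cz yz show "range (\<lambda>n. c0 (2 * n + 1)) \<subseteq> oc (range z \<union> range c)"
      "range (\<lambda>n. y (2 * n + 1)) \<subseteq> oc (range z \<union> range (\<lambda>n. y (2 * n)))"
      by (auto simp: oc_Un)
  next
    fix v assume "v \<in> fixator (range z)" "\<And>n. v (c n) = y (2 * n)"
    then show thesis by (rule that)
  qed
  note g1u = fixator_unitary[OF g1(1)]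
  define r where "r n = e n - t (2 * n) *\<^sub>C c n" for n
  have r: "r n \<in> oc (oc (range z))" for n
    using t by (simp add: r_def e_def c_def)
  \<comment> \<open>\<open>g1\<close> fixes \<open>r n\<close>, which lies in the closed span of
    \<open>z\<close>. So \<open>b n\<close> has components only there and along
    \<open>y (2 * n)\<close>, both orthogonal to \<open>x\<close>.\<close>
  define b where "b n = g1 (e n)" for n
  have b: "b n = t (2 * n) *\<^sub>C y (2 * n) + r n" for n
  proof -
    have "g1 (r n) = r n"
      using fixatorD[OF fixator_oc_oc[OF g1(1)] r] .
    moreover have "e n = t (2 * n) *\<^sub>C c n + r n"
      by (simp add: r_def)
    ultimately show ?thesis
      by (simp add: b_def unitary_additive[OF g1u] g1(2))
  qed
  have eo: "orthonormal e"
    unfolding e_def using e0 inj2(1) by (rule orthonormal_comp)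
  have rz: "cinner (r n) v = 0" "cinner v (r n) = 0" if "v \<in> oc (range z)" for n v
    using ocD[OF r that] ocD'[OF r that] .
  obtain g2 where g2: "g2 \<in> fixator (range x)" "\<And>n. g2 (b n) = z n"
  proof (rule fixator_transitive[OF separable infinite_UNIV_nat, of b "range x" "\<lambda>n. y (2 * n + 1)" z y])
    show "orthonormal b"
      unfolding b_def using g1u eo by (rule orthonormal_unitary)
    show "orthonormal (\<lambda>n. y (2 * n + 1))"
      using yo inj2(2) by (rule orthonormal_comp)
    show "orthonormal z" "orthonormal y"
      using z yo .
    have "b n \<in> oc (range x)" for n
    proof (rule ocI)
      fix s assume s: "s \<in> range x"
      then have "cinner (r n) s = 0"
        using rz xz by blast
      with ocD[OF yx s] show "cinner (b n) s = 0"
        by (simp add: b cinner_add_left cinner_scaleC_left)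
    qed
    then show "range b \<subseteq> oc (range x)"
      by auto
    show "range z \<subseteq> oc (range x)"
      using ocD'[OF subsetD[OF xz rangeI] rangeI] by (auto intro!: ocI)
    show "range y \<subseteq> oc (range x \<union> range z)"
      using onb_in_oc[OF y] by auto
    have "y (2 * n + 1) \<in> oc (range b)" for n
      by (auto intro!: ocI simp: b cinner_add_right cinner_scaleC_right rz[OF yz]
          orthonormalD[OF yo] parity)
    with yx show "range (\<lambda>n. y (2 * n + 1)) \<subseteq> oc (range x \<union> range b)"
      by (auto simp: oc_Un)
  next
    fix v assume "v \<in> fixator (range x)" "\<And>n. v (b n) = z n"
    then show thesis by (rule that)
  qed
  have "g2 \<circ> g1 \<in> compositions W (16 + 12)"
    using g1(1) g2(1) fx fz by (intro compositions_comp) auto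
  then have g28: "g2 \<circ> g1 \<in> compositions W 28"
    by simp
  define g where "g = g2 \<circ> g1"
  have gu: "unitary_operator g"
    using unitary_compositions[OF g28] by (simp add: g_def)
  have ge: "g (e n) = z n" for n
    using g2(2) by (simp add: g_def b_def)
  have "g \<circ> u \<circ> uinv g \<in> fixator (range z)"
  proof (rule fixatorI)
    show "unitary_operator (g \<circ> u \<circ> uinv g)"
      using gu uu unitary_inv(1)[OF gu] by (intro unitary_operator_comp)
    fix s assume "s \<in> range z"
    then obtain n where s: "s = g (e n)"
      using ge by auto
    moreover have "u (e n) = e n"
      using eM by (simp add: e_def M_def)
    ultimately show "(g \<circ> u \<circ> uinv g) s = s"
      using unitary_inv(2)[OF gu] by simp
  qed
  then have 12: "g \<circ> u \<circ> uinv g \<in> compositions W 12"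
    using fz by blast
  have "uinv g \<circ> (g \<circ> u \<circ> uinv g) \<circ> uinv (uinv g) \<in> compositions W (28 + 12 + 28)"
    using inv_compositions[OF g28] 12 unfolding g_def by (rule conj_compositions)
  moreover have "uinv g \<circ> (g \<circ> u \<circ> uinv g) \<circ> uinv (uinv g) = u"
    by (simp add: fun_eq_iff unitary_inv_inv[OF gu] unitary_inv(2)[OF gu])
  ultimately show ?thesis
    by simp
qed

theorem unitary_in_compositions:
  assumes u: "unitary_operator u"
  shows "u \<in> compositions W 136"
proof -
  obtain c :: "nat \<Rightarrow> 'a" where "onb {} c"
    using ex_onb_UNIV[OF separable infinite_dim] by blast
  then have c: "orthonormal c" "range c \<subseteq> oc {}" and u: "u \<in> fixator {}"
    using u by (auto dest: onb_orthonormal)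
  obtain w w' and x y :: "nat \<Rightarrow> 'a" where
    ww: "w \<in> fixator {}" "w' \<in> fixator {}" "u = w \<circ> w'"
    and x: "orthonormal x" "range x \<subseteq> oc {}" "w \<in> fixator (range x)"
    and y: "orthonormal y" "range y \<subseteq> oc {}" "w' \<in> fixator (range y)"
    by (rule fixator_factor[OF separable c u])
  have "u \<in> compositions W (68 + 68)"
    unfolding ww(3) using fixing_sequence_compositions[OF x(1,3)] fixing_sequence_compositions[OF y(1,3)]
    by (rule compositions_comp)
  then show ?thesis by simp
qed

end

section \<open>Separable topological groups\<close>

context topological_group
begin

lemma carrier_openin: "openin T V \<Longrightarrow> v \<in> V \<Longrightarrow> v \<in> carrier G"
  using openin_subset topspace_eq_carrier by blast

lemma ex_neighbourhood_mult:
  assumes "openin T V" "\<one> \<in> V"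
  obtains V' where "openin T V'" "\<one> \<in> V'" "\<And>x y. x \<in> V' \<Longrightarrow> y \<in> V' \<Longrightarrow> x \<otimes> y \<in> V"
proof -
  let ?P = "{p \<in> topspace (prod_topology T T). (\<lambda>(x, y). x \<otimes> y) p \<in> V}"
  have "openin (prod_topology T T) ?P"
    using continuous_mult assms(1) by (rule openin_continuous_map_preimage)
  moreover have "(\<one>, \<one>) \<in> ?P"
    using assms(2) by (simp add: topspace_eq_carrier)
  ultimately obtain A B where AB: "openin T A" "openin T B" "\<one> \<in> A" "\<one> \<in> B" "A \<times> B \<subseteq> ?P"
    unfolding openin_prod_topology_alt by meson
  show ?thesis
  proof
    show "openin T (A \<inter> B)" "\<one> \<in> A \<inter> B"
      using AB by auto
    fix x y assume "x \<in> A \<inter> B" "y \<in> A \<inter> B"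
    then have "(x, y) \<in> ?P"
      using AB(5) by blast
    then show "x \<otimes> y \<in> V"
      by simp
  qed
qed

lemma ex_neighbourhood_quotient:
  assumes "openin T V" "\<one> \<in> V"
  obtains V' where "openin T V'" "\<one> \<in> V'" "\<And>x y. x \<in> V' \<Longrightarrow> y \<in> V' \<Longrightarrow> inv x \<otimes> y \<in> V"
proof -
  obtain V1 where V1: "openin T V1" "\<one> \<in> V1" "\<And>x y. x \<in> V1 \<Longrightarrow> y \<in> V1 \<Longrightarrow> x \<otimes> y \<in> V"
    using ex_neighbourhood_mult[OF assms] by blast
  let ?P = "{x \<in> topspace T. inv x \<in> V1}"
  have "openin T ?P"
    using continuous_inv V1(1) by (rule openin_continuous_map_preimage)
  with V1 show ?thesis
    by (intro that[of "V1 \<inter> ?P"]) (auto simp: topspace_eq_carrier)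
qed

text \<open>For fixed \<open>k\<close> the points \<open>x\<close> with
  \<open>inv x \<otimes> k\<close> in \<open>V\<close> form an open set containing \<open>k\<close>,
  hence one that meets the dense set.\<close>

lemma countable_cover:
  assumes "separable_space T" "openin T V" "\<one> \<in> V"
  obtains d :: "nat \<Rightarrow> 'a" where "\<And>n. d n \<in> carrier G"
    "\<And>k. k \<in> carrier G \<Longrightarrow> \<exists>n. \<exists>v\<in>V. k = d n \<otimes> v"
proof -
  obtain D where D: "countable D" "D \<subseteq> carrier G" "T closure_of D = carrier G"
    using assms(1) by (auto simp: separable_space_def topspace_eq_carrier)
  have meet: "\<exists>x\<in>D. \<exists>v\<in>V. k = x \<otimes> v" if k: "k \<in> carrier G" for k
  proof -
    let ?P = "{x \<in> topspace T. inv x \<otimes> k \<in> V}"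
    have "continuous_map T (prod_topology T T) (\<lambda>x. (inv x, k))"
      using k continuous_inv by (intro continuous_map_pairedI) (auto simp: topspace_eq_carrier)
    from continuous_map_compose[OF this continuous_mult]
    have "continuous_map T T (\<lambda>x. inv x \<otimes> k)"
      by (simp add: o_def)
    then have "openin T ?P"
      using assms(2) by (rule openin_continuous_map_preimage)
    moreover have "k \<in> ?P"
      using k assms(3) by (simp add: topspace_eq_carrier)
    moreover have "k \<in> T closure_of D"
      using k D(3) by simp
    ultimately obtain x where "x \<in> D" "x \<in> ?P"
      unfolding in_closure_of by meson
    then have x: "x \<in> D" "inv x \<otimes> k \<in> V"
      by simp_all
    moreover from x(1) have "x \<in> carrier G"
      using D(2) by blast
    then have "k = x \<otimes> (inv x \<otimes> k)"
      using k by (simp flip: m_assoc)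
    ultimately show ?thesis
      by blast
  qed
  then have "D \<noteq> {}"
    using one_closed by blast
  then have range: "range (from_nat_into D) = D"
    using D(1) by (rule range_from_nat_into)
  show ?thesis
  proof (rule that)
    show "from_nat_into D n \<in> carrier G" for n
      using D(2) from_nat_into[OF \<open>D \<noteq> {}\<close>] by blast
    show "\<exists>n. \<exists>v\<in>V. k = from_nat_into D n \<otimes> v" if "k \<in> carrier G" for k
      using meet[OF that] range by (metis imageE)
  qed
qed

end

section \<open>From bounded products of unitaries to trivial homomorphisms\<close>

lemma compositions_mono: "W \<subseteq> W' \<Longrightarrow> compositions W n \<subseteq> compositions W' n"
  by (induction n) (simp, fastforce)

text \<open>The choices are made backwards: \<open>V\<close> avoids \<open>\<phi> u\<close>, then
  \<open>V1\<close> is such that 136 factors with images in \<open>V1\<close> compose to an element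
  with image in \<open>V\<close>, then \<open>V2\<close> has its quotients in \<open>V1\<close>, and
  only then is the group covered by translates of \<open>V2\<close>.\<close>

lemma hom_trivial_if_compact_unitaries_trivial:
  fixes K (structure) and \<phi> :: "('a::complex_hilbert_space \<Rightarrow> 'a) \<Rightarrow> 'b"
  assumes sep: "separable_space (euclidean :: 'a topology)"
    and inf: "infinite_dimensional_hilbert TYPE('a)"
    and K: "topological_group K T" "Hausdorff_space T" "separable_space T"
    and closed: "\<And>u. unitary_operator u \<Longrightarrow> \<phi> u \<in> carrier K"
    and comp: "\<And>u v. unitary_operator u \<Longrightarrow> unitary_operator v \<Longrightarrow> \<phi> (u \<circ> v) = \<phi> u \<otimes> \<phi> v"
    and compact: "\<And>u. u \<in> compact_unitaries \<Longrightarrow> \<phi> u = \<one>"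
    and u: "unitary_operator u"
  shows "\<phi> u = \<one>"
proof (rule ccontr)
  interpret topological_group K T by (rule K(1))
  have compact_unitary: "unitary_operator v" if "v \<in> compact_unitaries" for v :: "'a \<Rightarrow> 'a"
    using that by (simp add: compact_unitaries_def unitary_group_def)
  have "id \<in> (compact_unitaries :: ('a \<Rightarrow> 'a) set)"
    by (simp add: compact_unitaries_def unitary_group_def unitary_operator_id compact_operator_zero)
  then have phi_id: "\<phi> id = \<one>"
    by (rule compact)
  have phi_inv: "\<phi> (uinv v) = inv (\<phi> v)" if v: "unitary_operator v" for v
  proof -
    have "uinv v \<circ> v = id"
      by (auto simp: unitary_inv(2)[OF v])
    then have "\<phi> (uinv v) \<otimes> \<phi> v = \<one>"
      using comp[OF unitary_inv(1)[OF v] v] phi_id by simp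
    then show ?thesis
      using closed v unitary_inv(1)[OF v] by (metis inv_equality)
  qed
  have small: "\<exists>V'. openin T V' \<and> \<one> \<in> V' \<and>
      (\<forall>v \<in> compositions {w. unitary_operator w \<and> \<phi> w \<in> V'} n. unitary_operator v \<and> \<phi> v \<in> V)"
    if "openin T V" "\<one> \<in> V" for V n
    using that
  proof (induction n arbitrary: V)
    case 0
    then show ?case
      unfolding compositions.simps ball_simps
      by (intro exI[of _ V]) (simp only: phi_id unitary_operator_id simp_thms)
  next
    case (Suc n)
    obtain V1 where V1: "openin T V1" "\<one> \<in> V1" "\<And>x y. x \<in> V1 \<Longrightarrow> y \<in> V1 \<Longrightarrow> x \<otimes> y \<in> V"
      using ex_neighbourhood_mult[OF Suc.prems] by blast
    obtain V2 where V2: "openin T V2" "\<one> \<in> V2"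
      "\<And>v. v \<in> compositions {w. unitary_operator w \<and> \<phi> w \<in> V2} n \<Longrightarrow> unitary_operator v \<and> \<phi> v \<in> V1"
      using Suc.IH[OF V1(1,2)] by blast
    have "unitary_operator v \<and> \<phi> v \<in> V"
      if v: "v \<in> compositions {w. unitary_operator w \<and> \<phi> w \<in> V1 \<inter> V2} (Suc n)" for v
    proof -
      obtain w v' where w: "v = w \<circ> v'" "unitary_operator w" "\<phi> w \<in> V1"
        and "v' \<in> compositions {w. unitary_operator w \<and> \<phi> w \<in> V1 \<inter> V2} n"
        using v by auto
      then have "v' \<in> compositions {w. unitary_operator w \<and> \<phi> w \<in> V2} n"
        using compositions_mono[of "{w. unitary_operator w \<and> \<phi> w \<in> V1 \<inter> V2}"
            "{w. unitary_operator w \<and> \<phi> w \<in> V2}" n] by blast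
      then have "unitary_operator v'" "\<phi> v' \<in> V1"
        using V2(3) by auto
      with w show ?thesis
        by (simp add: comp V1(3) unitary_operator_comp)
    qed
    then show ?case
      by (intro exI[of _ "V1 \<inter> V2"] conjI ballI openin_Int IntI V1(1,2) V2(1,2)) blast+
  qed
  assume "\<phi> u \<noteq> \<one>"
  then obtain V V' where "openin T V" "\<one> \<in> V" "\<phi> u \<in> V'" "disjnt V V'"
    using K(2) closed[OF u] one_closed unfolding Hausdorff_space_def topspace_eq_carrier by metis
  then have V: "openin T V" "\<one> \<in> V" "\<phi> u \<notin> V"
    by (auto simp: disjnt_iff)
  obtain V1 where V1: "openin T V1" "\<one> \<in> V1"
    "\<And>v. v \<in> compositions {w. unitary_operator w \<and> \<phi> w \<in> V1} 136 \<Longrightarrow> \<phi> v \<in> V"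
    using small[OF V(1,2), of 136] by blast
  obtain V2 where V2: "openin T V2" "\<one> \<in> V2"
    "\<And>x y. x \<in> V2 \<Longrightarrow> y \<in> V2 \<Longrightarrow> inv x \<otimes> y \<in> V1"
    using ex_neighbourhood_quotient[OF V1(1,2)] by blast
  obtain d :: "nat \<Rightarrow> 'b" where d: "\<And>n. d n \<in> carrier K" "\<And>k. k \<in> carrier K \<Longrightarrow> \<exists>n. \<exists>v\<in>V2. k = d n \<otimes> v"
    using countable_cover[OF K(3) V2(1,2)] by blast
  have V2c: "v \<in> carrier K" if "v \<in> V2" for v
    using carrier_openin[OF V2(1) that] .
  define W where "W = {w. unitary_operator w \<and> (\<exists>x\<in>V2. \<exists>y\<in>V2. \<phi> w = inv x \<otimes> y)}"
  define C where "C n = {w. unitary_operator w \<and> (\<exists>v\<in>V2. \<phi> w = d n \<otimes> v)}" for n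
  interpret syndetic W C
  proof
    show "unitary_operator w" if "w \<in> W" for w
      using that by (simp add: W_def)
    show "unitary_operator w" if "w \<in> C n" for w n
      using that by (simp add: C_def)
    show "\<exists>n. w \<in> C n" if "unitary_operator w" for w
      using d(2)[OF closed[OF that]] that by (auto simp: C_def)
    show "compact_unitaries \<subseteq> W"
    proof
      fix w :: "'a \<Rightarrow> 'a" assume w: "w \<in> compact_unitaries"
      then have "\<phi> w = inv \<one> \<otimes> \<one>"
        using compact by simp
      with V2(2) compact_unitary[OF w] show "w \<in> W"
        unfolding W_def by blast
    qed
    show "uinv w \<in> W" if w: "w \<in> W" for w
    proof -
      obtain x y where xy: "x \<in> V2" "y \<in> V2" "\<phi> w = inv x \<otimes> y" and wu: "unitary_operator w"
        using w by (auto simp: W_def)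
      have "\<phi> (uinv w) = inv y \<otimes> x"
        using xy V2c by (simp add: phi_inv[OF wu] inv_mult_group)
      with xy unitary_inv(1)[OF wu] show ?thesis
        unfolding W_def by blast
    qed
    show "uinv v \<circ> w \<in> W" if vw: "v \<in> C n" "w \<in> C n" for v w n
    proof -
      obtain x y where xy: "x \<in> V2" "y \<in> V2" "\<phi> v = d n \<otimes> x" "\<phi> w = d n \<otimes> y"
        and vu: "unitary_operator v" and wu: "unitary_operator w"
        using vw by (auto simp: C_def)
      have "\<phi> (uinv v \<circ> w) = inv (d n \<otimes> x) \<otimes> (d n \<otimes> y)"
        by (simp add: comp[OF unitary_inv(1)[OF vu] wu] phi_inv[OF vu] xy)
      also have "\<dots> = inv x \<otimes> (inv (d n) \<otimes> (d n \<otimes> y))"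
        using xy V2c d(1) by (simp add: inv_mult_group m_assoc)
      also have "\<dots> = inv x \<otimes> y"
        using xy V2c d(1) by (simp flip: m_assoc)
      finally show ?thesis
        using xy vu wu unfolding W_def by (auto intro: unitary_operator_comp unitary_inv)
    qed
  qed (rule sep inf)+
  have "W \<subseteq> {w. unitary_operator w \<and> \<phi> w \<in> V1}"
    using V2(3) by (auto simp: W_def)
  then have "u \<in> compositions {w. unitary_operator w \<and> \<phi> w \<in> V1} 136"
    using unitary_in_compositions[OF u] compositions_mono by blast
  with V1(3) V(3) show False
    by blast
qed

theorem mainTheorem3:
  fixes K :: "('b, 'c) monoid_scheme" and T :: "'b topology"
    and h :: "('h::complex_hilbert_space \<Rightarrow> 'h) set \<Rightarrow> 'b"
  assumes "infinite_dimensional_hilbert TYPE('h)"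
    and "separable_space (euclidean :: 'h topology)"
    and "topological_group K T"
    and "Hausdorff_space T"
    and "separable_space T"
    and "h \<in> hom (unitary_group Mod compact_unitaries) K"
  shows "\<forall>x \<in> carrier (unitary_group Mod compact_unitaries). h x = \<one>\<^bsub>K\<^esub>"
proof
  let ?U = "unitary_group :: ('h \<Rightarrow> 'h) monoid"
  let ?N = "compact_unitaries :: ('h \<Rightarrow> 'h) set"
  interpret N: normal ?N ?U by (rule normal_compact_unitaries)
  interpret K: topological_group K T by (rule assms(3))
  interpret h: group_hom "?U Mod ?N" K h
    using assms(6) by (intro group_hom.intro N.factorgroup_is_group K.is_group group_hom_axioms.intro)
  define \<phi> where "\<phi> u = h (?N #>\<^bsub>?U\<^esub> u)" for u
  have carrier: "u \<in> carrier ?U \<longleftrightarrow> unitary_operator u" for u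
    by (simp add: unitary_group_def)
  have q: "(\<lambda>u. ?N #>\<^bsub>?U\<^esub> u) \<in> hom ?U (?U Mod ?N)"
    by (rule N.r_coset_hom_Mod)
  have trivial: "\<phi> u = \<one>\<^bsub>K\<^esub>" if "unitary_operator u" for u
  proof (rule hom_trivial_if_compact_unitaries_trivial[OF assms(2,1,3,4,5) _ _ _ that])
    show "\<phi> v \<in> carrier K" if "unitary_operator v" for v
      using hom_in_carrier[OF q, of v] that by (simp add: \<phi>_def carrier)
    show "\<phi> (v \<circ> w) = \<phi> v \<otimes>\<^bsub>K\<^esub> \<phi> w" if "unitary_operator v" "unitary_operator w" for v w
    proof -
      have "?N #>\<^bsub>?U\<^esub> (v \<otimes>\<^bsub>?U\<^esub> w) = (?N #>\<^bsub>?U\<^esub> v) \<otimes>\<^bsub>?U Mod ?N\<^esub> (?N #>\<^bsub>?U\<^esub> w)"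
        using that by (intro hom_mult[OF q]) (simp_all add: carrier)
      moreover have "v \<otimes>\<^bsub>?U\<^esub> w = v \<circ> w"
        by (simp add: unitary_group_def)
      ultimately have "\<phi> (v \<circ> w) = h ((?N #>\<^bsub>?U\<^esub> v) \<otimes>\<^bsub>?U Mod ?N\<^esub> (?N #>\<^bsub>?U\<^esub> w))"
        by (simp only: \<phi>_def)
      also have "\<dots> = \<phi> v \<otimes>\<^bsub>K\<^esub> \<phi> w"
        unfolding \<phi>_def using that by (intro h.hom_mult hom_in_carrier[OF q]) (simp_all add: carrier)
      finally show ?thesis .
    qed
    show "\<phi> v = \<one>\<^bsub>K\<^esub>" if "v \<in> ?N" for v
    proof -
      have "?N #>\<^bsub>?U\<^esub> v = ?N"
        using that by (rule N.rcos_const[OF N.is_group])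
      then show ?thesis
        using h.hom_one by (simp add: \<phi>_def FactGroup_def)
    qed
  qed
  fix x assume "x \<in> carrier (?U Mod ?N)"
  then obtain u where "u \<in> carrier ?U" "x = ?N #>\<^bsub>?U\<^esub> u"
    by (auto simp: FactGroup_def RCOSETS_def)
  with trivial[of u] show "h x = \<one>\<^bsub>K\<^esub>"
    by (simp add: \<phi>_def carrier)
qed

end
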